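(* Let $1<\alpha\le3$. Assume that $\mathbf P(X_1=t)=t^{-\alpha}L_1(t)$ for $t=1,2,\dots$, where $L_1$ is slowly varying at infinity, and that $\mathbf E N^{1+\tau}<\infty$ for some $\tau>0$. If $2<\alpha\le3$, assume also that $\mathbf P(X_1<-t)=O\bigl(\mathbf P(X_1>t)\bigr)$ as $t\to+\infty$. If $2<\alpha\le3$ and $\mu>0$, assume in addition that $\mathbf P(N=t)=O(t^{-\alpha-\beta})$ as $t\to+\infty$ for some $\beta>0$. Then, as $t\to+\infty$ through the integers, $$\mathbf P(S_N=t)\sim(\mathbf E N)\,\mathbf P(X_1=t).$$
   Context: $X_1,X_2,\dots$ are i.i.d. integer valued random variables (not necessarily non-negative); $N$ is a non-negative integer valued random variable independent of $\{X_i\}$; $S_N=X_1+\dots+X_N$ (with $S_0=0$). When $X_1$ has a finite first moment, $\mu=\mathbf E X_1$. $f(t)\sim g(t)$ means $f(t)/g(t)\to1$ as $t\to+\infty$. *)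

theory Defs
  imports "HOL-Probability.Probability" "HOL-Library.Landau_Symbols"
begin

text \<open>
  Slow variation at infinity: positivity and measurability are only required on a
  neighbourhood of infinity.
\<close>

definition slowly_varying :: "(real \<Rightarrow> real) \<Rightarrow> bool" where
  "slowly_varying L \<longleftrightarrow>
     (\<exists>a>0. (\<forall>x\<ge>a. 0 < L x) \<and> L \<in> borel_measurable (lebesgue_on {a..})) \<and>
     (\<forall>c>0. ((\<lambda>x. L (c * x) / L x) \<longlongrightarrow> 1) at_top)"

text \<open>
  \<open>N\<close> is independent of the whole sequence \<open>X\<close>: the sigma-algebras they generate are
  independent. (The library's \<open>indep_var\<close> needs both variables to have the same range type.)
\<close>

definition indep_of_sequence :: "'a measure \<Rightarrow> ('a \<Rightarrow> nat) \<Rightarrow> (nat \<Rightarrow> 'a \<Rightarrow> int) \<Rightarrow> bool" where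
  "indep_of_sequence M N X \<longleftrightarrow>
     prob_space.indep_set M
       (sets (vimage_algebra (space M) N (count_space UNIV)))
       (sets (vimage_algebra (space M) (\<lambda>\<omega> i. X i \<omega>) (\<Pi>\<^sub>M i\<in>UNIV. count_space UNIV)))"

end

theory Submission imports Defs "HOL-Real_Asymp.Real_Asymp" begin

text \<open>
  Write \<open>p t = P(X\<^sub>1 = t)\<close> and \<open>u n t = P(S\<^sub>n = t)\<close>. For fixed \<open>n\<close>, \<open>u n t / p t\<close> tends to \<open>n\<close> because a
  large value of \<open>S\<^sub>n\<close> comes from one large jump, so the theorem amounts to interchanging this limit
  with the sum over the values of \<open>N\<close>.

  If \<open>n \<le> t powr k\<close> with \<open>k < \<alpha> - 1\<close>, and \<open>2 n \<mu> \<le> t\<close> when the drift \<open>\<mu>\<close> is positive and finite, then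
  \<open>u n t \<le> C n p t\<close>: an exponential tilt of order \<open>ln t / t\<close> makes \<open>S\<^sub>n = t\<close> negligible without a jump
  larger than a small multiple of \<open>t\<close>, and each of the \<open>n\<close> possible such jumps contributes at
  most a multiple of \<open>p t\<close>. For larger \<open>n\<close>, splitting off a uniform component of the law of \<open>X\<^sub>1\<close> yields
  the concentration bound \<open>u n t \<le> C n powr (- 1 / g)\<close> for every \<open>g > \<alpha> - 1\<close>, which is at most
  \<open>C n powr (1 + \<tau>) p t\<close> when \<open>k\<close> and \<open>g\<close> are close to \<open>\<alpha> - 1\<close>. Dominated convergence then applies.
  With \<open>\<alpha> > 2\<close> and positive drift, the terms \<open>n > t / (2 \<mu>)\<close> are bounded by
  \<open>C t powr (- \<alpha> - \<beta>)\<close> times the Green function \<open>\<Sum>n. u n t\<close>, which is bounded since the walk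
  is transient.
\<close>

text \<open>The two bounds meet at n = t powr (\<alpha> - 1), where n powr (- 1 / (\<alpha> - 1))
  and n p t are both t powr (- 1) up to slow variation. So nothing is left over for the small losses
  in the exponents; the moment of order 1 + \<tau> pays for them.

  The single-jump range reaches almost up to that point because the Taylor remainder of the
  exponential moment is taken at an order k just below \<alpha> - 1. For \<alpha> \<le> 2 a
  first-order remainder suffices, and it involves the positive part of X only. For \<alpha> > 2 the
  mean has to be split off, which requires moments of the negative part as well; the second-order
  remainder allows k \<le> 2, and this is where \<alpha> \<le> 3 enters.

  A positive drift \<mu> is a genuine obstacle: for n near t / \<mu> the sum reaches t without any
  large jump, so no bound by a multiple of n p t can be expected there. Smallness must then come
  from P(N = n) itself.\<close>

section \<open>Slowly varying functions: uniform comparison, Potter bounds and shifts\<close>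

text \<open>
  For large \<open>x\<close>, the set of factors \<open>c \<in> [1, 4]\<close> that are bad for \<open>x\<close> has small measure, by dominated
  convergence. Hence every \<open>c \<in> [1, 2]\<close> admits a \<open>z \<in> [2, 4]\<close> such that \<open>z\<close> is good for \<open>x\<close> and
  \<open>z / c\<close> is good for \<open>c x\<close>, and \<open>L (c x)\<close> is compared with \<open>L x\<close> through \<open>L (z x)\<close>.
\<close>

lemma slowly_varying_uniform:
  assumes "slowly_varying L" "0 < e"
  obtains x0 where "0 < x0"
    "\<And>x. x0 \<le> x \<Longrightarrow> 0 < L x"
    "\<And>x c. x0 \<le> x \<Longrightarrow> 1 \<le> c \<Longrightarrow> c \<le> 2 \<Longrightarrow> \<bar>ln (L (c * x)) - ln (L x)\<bar> \<le> e"
proof -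
  obtain a where a: "0 < a" "\<And>x. a \<le> x \<Longrightarrow> 0 < L x"
    and meas: "L \<in> borel_measurable (lebesgue_on {a..})"
    and lim: "\<And>c. 0 < c \<Longrightarrow> ((\<lambda>x. L (c * x) / L x) \<longlongrightarrow> 1) at_top"
    using assms(1) unfolding slowly_varying_def by blast
  \<comment> \<open>\<open>L\<close> is measurable only on \<open>{a..}\<close>; extending its
    logarithm by 0 gives a function that is measurable on the whole line.\<close>
  define H where "H = (\<lambda>x. if x \<in> {a..} then ln (L x) else 0)"
  have H_meas [measurable]: "H \<in> borel_measurable lebesgue"
  proof -
    have "(\<lambda>x. ln (L x)) \<in> borel_measurable (lebesgue_on {a..})"
      using meas by measurable
    then show ?thesis
      unfolding H_def by (subst (asm) measurable_restrict_space_iff) auto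
  qed
  have H_scale [measurable]: "(\<lambda>c. H (c * x)) \<in> borel_measurable lebesgue" for x
  proof -
    have "(\<lambda>c::real. x *\<^sub>R c) \<in> lebesgue \<rightarrow>\<^sub>M lebesgue"
      by (rule lebesgue_measurable_scaling)
    from measurable_compose[OF this H_meas] show ?thesis
      by (simp add: mult.commute)
  qed
  define bad where "bad x = {c \<in> {1..4}. e / 2 \<le> \<bar>H (c * x) - H x\<bar>}" for x
  have bad_sets [measurable]: "bad x \<in> sets lebesgue" for x
  proof -
    have "(\<lambda>c. \<bar>H (c * x) - H x\<bar>) \<in> borel_measurable lebesgue"
      by (intro borel_measurable_abs borel_measurable_diff H_scale) simp
    then have "{c \<in> space lebesgue. e / 2 \<le> \<bar>H (c * x) - H x\<bar>} \<in> sets lebesgue"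
      by (intro borel_measurable_le) auto
    moreover have "bad x = {1..4} \<inter> {c \<in> space lebesgue. e / 2 \<le> \<bar>H (c * x) - H x\<bar>}"
      by (auto simp: bad_def)
    moreover have "{1..4::real} \<in> sets lebesgue" by simp
    ultimately show ?thesis by (simp only: sets.Int)
  qed
  have bad_lmeas: "bad x \<in> lmeasurable" for x
    by (rule bounded_set_imp_lmeasurable[OF _ bad_sets])
       (rule bounded_subset[of "{1..4}"], auto simp: bad_def)
  have "((\<lambda>x. \<integral>c. (indicator (bad x) c :: real) \<partial>lebesgue) \<longlongrightarrow> integral\<^sup>L lebesgue (\<lambda>c::real. 0::real)) (at_top :: real filter)"
  proof (rule integral_dominated_convergence_at_top
        [where s = "\<lambda>x. indicator (bad x)" and w = "indicator {1..4}" and f = "\<lambda>_. 0"])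
    show "integrable lebesgue (indicator {1..4::real} :: real \<Rightarrow> real)" by simp
    show "\<forall>\<^sub>F x in at_top. AE c in lebesgue. norm (indicator (bad x) c :: real) \<le> indicator {1..4} c"
      by (intro always_eventually allI AE_I2) (auto simp: bad_def indicator_def)
    show "AE c in lebesgue. ((\<lambda>x. indicator (bad x) c :: real) \<longlongrightarrow> 0) at_top"
    proof (intro AE_I2)
      fix c :: real
      show "((\<lambda>x. indicator (bad x) c :: real) \<longlongrightarrow> 0) at_top"
      proof (cases "c \<in> {1..4}")
        case True
        then have c: "1 \<le> c" by simp
        have "((\<lambda>x. ln (L (c * x) / L x)) \<longlongrightarrow> ln 1) at_top"
          using lim[of c] c by (intro tendsto_ln) auto
        then have "\<forall>\<^sub>F x in at_top. dist (ln (L (c * x) / L x)) 0 < e / 2"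
          using assms(2) half_gt_zero[of e] unfolding tendsto_iff ln_one by blast
        then have "\<forall>\<^sub>F x in at_top. c \<notin> bad x"
          using eventually_ge_at_top[of a]
        proof eventually_elim
          case (elim x)
          have "a \<le> c * x" using elim c a(1) mult_mono[of 1 c a x] by simp
          then have "H (c * x) - H x = ln (L (c * x) / L x)"
            using elim a(2)[of x] a(2)[of "c * x"] by (simp add: H_def ln_div)
          then show ?case using elim by (auto simp: bad_def dist_real_def)
        qed
        then show ?thesis
          by (intro tendsto_eventually) (auto elim: eventually_mono)
      qed (auto simp: bad_def)
    qed
  qed measurable
  then have "((\<lambda>x. measure lebesgue (bad x)) \<longlongrightarrow> 0) at_top"
    by simp
  then have "\<forall>\<^sub>F x in at_top. measure lebesgue (bad x) < 1 / 4"
    by (rule order_tendstoD) simp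
  then obtain x1 where x1: "\<And>x. x1 \<le> x \<Longrightarrow> measure lebesgue (bad x) < 1 / 4"
    by (auto simp: eventually_at_top_linorder)
  define x0 where "x0 = max a x1"
  have "\<bar>ln (L (c * x)) - ln (L x)\<bar> \<le> e" if x: "x0 \<le> x" and c: "1 \<le> c" "c \<le> 2" for x c
  proof -
    have xa: "a \<le> x" "x1 \<le> x" "0 < x" using x a(1) by (auto simp: x0_def)
    have cx: "x \<le> c * x" using c xa by simp
    \<comment> \<open>\<open>T\<close> holds the factors z for which z / c is bad for c x. The
      dilation at most doubles the measure, so \<open>bad x\<close> and \<open>T\<close> together
      have measure at most 3/4, less than the length 2 of [2, 4]. The \<open>+ 0\<close> puts the
      dilation into affine form.\<close>
    define T where "T = (\<lambda>z. c *\<^sub>R z + 0) ` bad (c * x)"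
    have T_eq: "T = (\<lambda>z. c *\<^sub>R z) ` bad (c * x)" by (simp add: T_def)
    have T_lmeas: "T \<in> lmeasurable"
    proof (rule bounded_set_imp_lmeasurable)
      have "T = ((*\<^sub>R) (1 / c)) -` bad (c * x) \<inter> space lebesgue"
        using c by (force simp: T_eq image_iff)
      then show "T \<in> sets lebesgue"
        using measurable_sets[OF lebesgue_measurable_scaling bad_sets] by simp
      show "bounded T"
        unfolding T_eq by (rule bounded_scaling, rule bounded_subset[of "{1..4}"]) (auto simp: bad_def)
    qed
    have T_meas: "measure lebesgue T = c * measure lebesgue (bad (c * x))"
      unfolding T_def using c by (subst measure_lebesgue_affine) simp
    have "\<exists>z\<in>{2..4}. z \<notin> bad x \<union> T"
    proof (rule ccontr)
      assume "\<not> ?thesis"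
      then have "{2..4} \<subseteq> bad x \<union> T" by blast
      then have "measure lebesgue {2..4::real} \<le> measure lebesgue (bad x \<union> T)"
        by (intro measure_mono_fmeasurable) (auto intro: fmeasurable.Un bad_lmeas T_lmeas)
      also have "\<dots> \<le> measure lebesgue (bad x) + measure lebesgue T"
        by (intro measure_Un_le) (use bad_sets T_lmeas in auto)
      also have "\<dots> \<le> 1 / 4 + 2 * (1 / 4)"
        unfolding T_meas using x1[of x] x1[of "c * x"] xa cx c
        by (intro add_mono mult_mono) auto
      finally show False by simp
    qed
    then obtain z where z: "2 \<le> z" "z \<le> 4" "z \<notin> bad x" "z \<notin> T" by auto
    have "z / c \<notin> bad (c * x)"
      using z(4) c unfolding T_eq by (auto simp: image_iff)
    moreover have "z / c \<in> {1..4}"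
      using z c by (auto simp: field_simps)
    ultimately have 1: "\<bar>H (z * x) - H (c * x)\<bar> < e / 2"
      using c by (auto simp: bad_def)
    have 2: "\<bar>H (z * x) - H x\<bar> < e / 2"
      using z by (auto simp: bad_def)
    have "\<bar>H (c * x) - H x\<bar> \<le> e" using 1 2 by linarith
    then show ?thesis using xa cx by (auto simp: H_def)
  qed
  then show thesis
    using that[of x0] a by (auto simp: x0_def)
qed

text \<open>The uniform comparison is chained over dyadic scales: at most log 2 (y / x) + 1 steps,
  each costing e ln 2. The additive 1 pays for the last, incomplete scale. Exponentiated, this
  compares L y / L x with powers of y / x of exponent e and -e.\<close>

lemma slowly_varying_Potter:
  assumes "slowly_varying L" "0 < e"
  obtains x0 where "1 \<le> x0"
    "\<And>x. x0 \<le> x \<Longrightarrow> 0 < L x"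
    "\<And>x y. x0 \<le> x \<Longrightarrow> x \<le> y \<Longrightarrow> \<bar>ln (L y) - ln (L x)\<bar> \<le> e * (1 + ln (y / x))"
proof -
  define d where "d = e * ln 2"
  have d: "0 < d" using assms(2) by (simp add: d_def)
  obtain x0 where x0: "0 < x0" "\<And>x. x0 \<le> x \<Longrightarrow> 0 < L x"
    and unif: "\<And>x c. x0 \<le> x \<Longrightarrow> 1 \<le> c \<Longrightarrow> c \<le> 2 \<Longrightarrow> \<bar>ln (L (c * x)) - ln (L x)\<bar> \<le> d"
    using slowly_varying_uniform[OF assms(1) d] by metis
  have dyadic: "\<bar>ln (L y) - ln (L x)\<bar> \<le> real j * d"
    if "x0 \<le> x" "x \<le> y" "y \<le> 2 ^ j * x" for x y j
    using that
  proof (induction j arbitrary: y)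
    case (Suc j)
    show ?case
    proof (cases "y \<le> 2 ^ j * x")
      case True
      then have "\<bar>ln (L y) - ln (L x)\<bar> \<le> real j * d" using Suc by auto
      then show ?thesis using d by (simp add: algebra_simps)
    next
      case False
      \<comment> \<open>The intermediate point stays above \<open>x\<close>, so that the induction
        hypothesis and the threshold \<open>x0\<close> apply, and is within a factor 2 of
        \<open>y\<close>.\<close>
      define z where "z = max x (y / 2)"
      have pos: "0 < x" "0 < z" using Suc.prems x0 by (auto simp: z_def)
      have "x \<le> 2 ^ j * x" using pos by simp
      then have z: "x \<le> z" "z \<le> 2 ^ j * x" using Suc.prems by (auto simp: z_def)
      have "1 \<le> y / z" "y / z \<le> 2"
        using pos Suc.prems by (auto simp: z_def field_simps)
      then have "\<bar>ln (L (y / z * z)) - ln (L z)\<bar> \<le> d"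
        using unif[of z "y / z"] z Suc.prems by auto
      then have "\<bar>ln (L y) - ln (L z)\<bar> \<le> d" using pos by simp
      moreover have "\<bar>ln (L z) - ln (L x)\<bar> \<le> real j * d"
        using Suc.IH[OF Suc.prems(1) z] .
      ultimately show ?thesis by (simp add: algebra_simps)
    qed
  qed auto
  have "\<bar>ln (L y) - ln (L x)\<bar> \<le> e * (1 + ln (y / x))" if "x0 \<le> x" "x \<le> y" for x y
  proof -
    have x: "0 < x" "1 \<le> y / x" using that x0 by auto
    define j where "j = nat \<lceil>log 2 (y / x)\<rceil>"
    have lg: "0 \<le> log 2 (y / x)" using x by simp
    then have j: "log 2 (y / x) \<le> real j" "real j \<le> log 2 (y / x) + 1"
      unfolding j_def by linarith+
    have "y / x = 2 powr log 2 (y / x)" using x by simp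
    also have "\<dots> \<le> 2 powr real j" using j by (intro powr_mono) auto
    also have "\<dots> = 2 ^ j" by (simp add: powr_realpow)
    finally have "y \<le> 2 ^ j * x" using x by (simp add: field_simps)
    then have "\<bar>ln (L y) - ln (L x)\<bar> \<le> real j * d" using dyadic that by blast
    also have "\<dots> \<le> (log 2 (y / x) + 1) * d" using j d by (intro mult_right_mono) auto
    also have "\<dots> = e * (ln 2 + ln (y / x))" by (simp add: d_def log_def field_simps)
    also have "\<dots> \<le> e * (1 + ln (y / x))"
      using assms(2) ln_le_minus_one[of 2] by (intro mult_left_mono) auto
    finally show ?thesis .
  qed
  then show thesis
    using that[of "max 1 x0"] x0 by auto
qed

text \<open>The factor (t - k) / t depends on t, so the comparison has to be uniform in the factor.
  The sign of \<open>k\<close> decides which of the two arguments is the smaller one.\<close>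

lemma slowly_varying_shift:
  assumes "slowly_varying L"
  shows "(\<lambda>t::nat. L (real t - k) / L (real t)) \<longlonglongrightarrow> 1"
proof -
  have "(\<lambda>t::nat. ln (L (real t - k)) - ln (L (real t))) \<longlonglongrightarrow> 0"
  proof (rule tendstoI)
    fix e :: real assume e: "0 < e"
    obtain x0 where x0: "0 < x0" and unif:
      "\<And>x c. x0 \<le> x \<Longrightarrow> 1 \<le> c \<Longrightarrow> c \<le> 2 \<Longrightarrow> \<bar>ln (L (c * x)) - ln (L x)\<bar> \<le> e / 2"
      using slowly_varying_uniform[OF assms, of "e / 2"] e by (metis half_gt_zero)
    have cmp: "\<bar>ln (L y) - ln (L x)\<bar> \<le> e / 2" if "x0 \<le> x" "x \<le> y" "y \<le> 2 * x" for x y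
      using unif[of x "y / x"] that x0 by (simp add: field_simps)
    have "\<forall>\<^sub>F t::nat in sequentially. x0 + 2 * \<bar>k\<bar> \<le> real t"
      by real_asymp
    then show "\<forall>\<^sub>F t::nat in sequentially. dist (ln (L (real t - k)) - ln (L (real t))) 0 < e"
    proof eventually_elim
      case (elim t)
      show ?case
      proof (cases "0 \<le> k")
        case True
        then have "\<bar>ln (L (real t)) - ln (L (real t - k))\<bar> \<le> e / 2"
          using elim x0 by (intro cmp) auto
        then show ?thesis using e by (simp add: dist_real_def abs_minus_commute)
      next
        case False
        then have "\<bar>ln (L (real t - k)) - ln (L (real t))\<bar> \<le> e / 2"
          using elim x0 by (intro cmp) auto
        then show ?thesis using e by (simp add: dist_real_def)
      qed
    qed
  qed
  then have "(\<lambda>t::nat. exp (ln (L (real t - k)) - ln (L (real t)))) \<longlonglongrightarrow> 1"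
    using tendsto_exp by fastforce
  moreover obtain x0 where x0: "\<And>x. x0 \<le> x \<Longrightarrow> 0 < L x"
    using slowly_varying_uniform[OF assms, of 1] by (metis zero_less_one)
  have "\<forall>\<^sub>F t::nat in sequentially. x0 + \<bar>k\<bar> \<le> real t"
    by real_asymp
  then have "\<forall>\<^sub>F t::nat in sequentially.
      exp (ln (L (real t - k)) - ln (L (real t))) = L (real t - k) / L (real t)"
  proof eventually_elim
    case (elim t)
    have "0 < L (real t)" "0 < L (real t - k)"
      using elim by (auto intro!: x0)
    then show ?case by (simp add: exp_diff)
  qed
  ultimately show ?thesis by (rule Lim_transform_eventually)
qed

section \<open>The step law: regular variation of its mass function\<close>

text \<open>Only the masses at positive integers are prescribed. The left tail enters later, as an
  explicit hypothesis of the lemmas concerned.\<close>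

locale regvar_pmf =
  fixes F :: "int pmf" and L :: "real \<Rightarrow> real" and \<alpha> :: real
  assumes L: "slowly_varying L"
    and \<alpha>_gt_1: "1 < \<alpha>"
    and pmf_eq: "\<And>t::int. 1 \<le> t \<Longrightarrow> pmf F t = real_of_int t powr (-\<alpha>) * L (real_of_int t)"
begin

lemma pmf_ratio_eq:
  assumes "0 < L x" "0 < L y" "0 < x" "0 < y"
  shows "ln (y powr (-\<alpha>) * L y) = ln (x powr (-\<alpha>) * L x) - \<alpha> * ln (y / x) + (ln (L y) - ln (L x))"
  using assms by (simp add: ln_mult ln_div ln_powr algebra_simps)

text \<open>Potter's bounds for \<open>L\<close>, with both exponents shifted by -\<alpha>; the
  factors exp e and exp (-e) stem from the additive 1.\<close>

lemma pmf_Potter: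
  assumes "0 < e"
  obtains t0 :: int where "1 \<le> t0"
    "\<And>t. t0 \<le> t \<Longrightarrow> 0 < pmf F t"
    "\<And>s t. t0 \<le> s \<Longrightarrow> s \<le> t \<Longrightarrow>
       exp (-e) * (t / s) powr (-\<alpha> - e) * pmf F s \<le> pmf F t"
    "\<And>s t. t0 \<le> s \<Longrightarrow> s \<le> t \<Longrightarrow>
       pmf F t \<le> exp e * (t / s) powr (-\<alpha> + e) * pmf F s"
proof -
  obtain x0 where x0: "1 \<le> x0" "\<And>x. x0 \<le> x \<Longrightarrow> 0 < L x"
    and P: "\<And>x y. x0 \<le> x \<Longrightarrow> x \<le> y \<Longrightarrow> \<bar>ln (L y) - ln (L x)\<bar> \<le> e * (1 + ln (y / x))"
    using slowly_varying_Potter[OF L assms] by metis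
  define t0 where "t0 = \<lceil>x0\<rceil>"
  have t0: "x0 \<le> real_of_int t" if "t0 \<le> t" for t
    using that unfolding t0_def by linarith
  have pos: "0 < pmf F t" if "t0 \<le> t" for t
  proof -
    have "1 \<le> t" using t0[OF that] x0(1) by linarith
    then show ?thesis using x0(2)[OF t0[OF that]] by (simp add: pmf_eq)
  qed
  have key: "\<bar>ln (pmf F t) - ln (pmf F s) + \<alpha> * ln (real_of_int t / real_of_int s)\<bar>
      \<le> e * (1 + ln (real_of_int t / real_of_int s))"
    if "t0 \<le> s" "s \<le> t" for s t
  proof -
    have *: "1 \<le> s" "1 \<le> t" using t0[OF that(1)] x0(1) that by linarith+
    have "ln (pmf F t) - ln (pmf F s) + \<alpha> * ln (real_of_int t / real_of_int s)
        = ln (L t) - ln (L s)"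
      using * that t0 x0 by (simp add: pmf_eq pmf_ratio_eq[of "real_of_int s" "real_of_int t"])
    then show ?thesis using P[of s t] that t0 by auto
  qed
  show thesis
  proof (rule that)
    show "1 \<le> t0" using x0(1) unfolding t0_def by linarith
    show "0 < pmf F t" if "t0 \<le> t" for t using pos[OF that] .
    fix s t :: int assume st: "t0 \<le> s" "s \<le> t"
    have s: "0 < real_of_int s" "0 < real_of_int t" using st \<open>1 \<le> t0\<close> by auto
    have ps: "0 < pmf F s" "0 < pmf F t" using st pos by auto
    define r where "r = real_of_int t / real_of_int s"
    have r: "0 < r" using s by (simp add: r_def)
    have le: "\<bar>ln (pmf F t) - ln (pmf F s) + \<alpha> * ln r\<bar> \<le> e * (1 + ln r)"
      using key[OF st] by (simp add: r_def)
    have "ln (exp (-e) * r powr (-\<alpha> - e) * pmf F s) = - e + (-\<alpha> - e) * ln r + ln (pmf F s)"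
      using r ps by (simp add: ln_mult ln_powr)
    also have "\<dots> \<le> ln (pmf F t)" using le by (simp add: algebra_simps abs_le_iff)
    finally show "exp (-e) * (t / s) powr (-\<alpha> - e) * pmf F s \<le> pmf F t"
      using r ps s by (subst (asm) ln_le_cancel_iff) (simp_all add: r_def zero_less_mult_iff)
    have "ln (pmf F t) \<le> e + (-\<alpha> + e) * ln r + ln (pmf F s)"
      using le by (simp add: algebra_simps abs_le_iff)
    also have "\<dots> = ln (exp e * r powr (-\<alpha> + e) * pmf F s)"
      using r ps by (simp add: ln_mult ln_powr)
    finally show "pmf F t \<le> exp e * (t / s) powr (-\<alpha> + e) * pmf F s"
      using r ps s by (subst (asm) ln_le_cancel_iff) (simp_all add: r_def zero_less_mult_iff)
  qed
qed

lemma pmf_eventually_pos: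
  obtains t0 :: int where "1 \<le> t0" "\<And>t. t0 \<le> t \<Longrightarrow> 0 < pmf F t"
  using pmf_Potter[of 1] by (metis zero_less_one)

lemma pmf_lower:
  assumes "0 < e"
  obtains c t0 where "0 < c" "1 \<le> t0"
    "\<And>t::int. t0 \<le> t \<Longrightarrow> c * real_of_int t powr (-\<alpha> - e) \<le> pmf F t"
proof -
  obtain t0 :: int where t0: "1 \<le> t0" "0 < pmf F t0"
    and low: "\<And>t. t0 \<le> t \<Longrightarrow> exp (-e) * (t / t0) powr (-\<alpha> - e) * pmf F t0 \<le> pmf F t"
    using pmf_Potter[OF assms] by (metis order_refl)
  show thesis
  proof (rule that)
    show "0 < exp (-e) * (1 / t0) powr (-\<alpha> - e) * pmf F t0" using t0 by simp
    show "1 \<le> t0" by fact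
    fix t :: int assume "t0 \<le> t"
    with low[OF this] t0 show
      "exp (-e) * (1 / t0) powr (-\<alpha> - e) * pmf F t0 * real_of_int t powr (-\<alpha> - e) \<le> pmf F t"
      by (simp add: powr_divide mult_ac)
  qed
qed

lemma pmf_upper:
  assumes "0 < e"
  obtains C where "0 < C" "\<And>t::int. 1 \<le> t \<Longrightarrow> pmf F t \<le> C * real_of_int t powr (-\<alpha> + e)"
proof -
  obtain t0 :: int where t0: "1 \<le> t0" "0 < pmf F t0"
    and up: "\<And>t. t0 \<le> t \<Longrightarrow> pmf F t \<le> exp e * (t / t0) powr (-\<alpha> + e) * pmf F t0"
    using pmf_Potter[OF assms] by (metis order_refl)
  define C1 where "C1 = exp e * (1 / t0) powr (-\<alpha> + e) * pmf F t0"
  \<comment> \<open>Covers the finitely many t below \<open>t0\<close>, where only pmf F t \<le> 1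
    is known.\<close>
  define C2 where "C2 = real_of_int t0 powr \<alpha>"
  have C: "0 < C1" "0 < C2" using t0 by (auto simp: C1_def C2_def)
  show thesis
  proof (rule that)
    show "0 < C1 + C2" using C by simp
    fix t :: int assume t: "1 \<le> t"
    show "pmf F t \<le> (C1 + C2) * real_of_int t powr (-\<alpha> + e)"
    proof (cases "t0 \<le> t")
      case True
      then have "pmf F t \<le> C1 * real_of_int t powr (-\<alpha> + e)"
        using up[OF True] t0 t by (simp add: powr_divide C1_def mult_ac)
      also have "\<dots> \<le> (C1 + C2) * real_of_int t powr (-\<alpha> + e)"
        using C by (intro mult_right_mono) auto
      finally show ?thesis .
    next
      case False
      have "pmf F t \<le> 1" by (rule pmf_le_1)
      also have "1 = real_of_int t powr \<alpha> * real_of_int t powr (-\<alpha>)"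
        using t by (simp flip: powr_add)
      also have "\<dots> \<le> C2 * real_of_int t powr (-\<alpha> + e)"
        unfolding C2_def using t False assms \<alpha>_gt_1
        by (intro mult_mono powr_mono2 powr_mono) auto
      also have "\<dots> \<le> (C1 + C2) * real_of_int t powr (-\<alpha> + e)"
        using C by (intro mult_right_mono) auto
      finally show ?thesis .
    qed
  qed
qed

text \<open>The mass function need not be monotone, but it is so up to a constant: Potter's upper
  bound with the negative exponent 1 - \<alpha> treats s \<ge> t, and the lower bound with t / s
  \<le> m treats the rest at the price m powr (\<alpha> + 1). The threshold m t0 ensures that s
  itself exceeds t0. In this form every jump beyond a fixed fraction of t costs a multiple of pmf F
  t.\<close>

lemma pmf_almost_decreasing:
  assumes "1 \<le> m"
  obtains C t0 where "1 \<le> C" "1 \<le> t0"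
    "\<And>t. t0 \<le> t \<Longrightarrow> 0 < pmf F t"
    "\<And>s t::int. t0 \<le> t \<Longrightarrow> real_of_int t / m \<le> real_of_int s \<Longrightarrow> pmf F s \<le> C * pmf F t"
proof -
  obtain t0 :: int where t0: "1 \<le> t0" "\<And>t. t0 \<le> t \<Longrightarrow> 0 < pmf F t"
    and low: "\<And>s t. t0 \<le> s \<Longrightarrow> s \<le> t \<Longrightarrow> exp (-1) * (t / s) powr (-\<alpha> - 1) * pmf F s \<le> pmf F t"
    and up: "\<And>s t. t0 \<le> s \<Longrightarrow> s \<le> t \<Longrightarrow> pmf F t \<le> exp 1 * (t / s) powr (-\<alpha> + 1) * pmf F s"
    using pmf_Potter[of 1] by (metis zero_less_one)
  define C where "C = exp 1 * m powr (\<alpha> + 1)"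
  have m1: "1 \<le> m powr (\<alpha> + 1)" using assms \<alpha>_gt_1 by (intro ge_one_powr_ge_zero) auto
  have e1: "1 \<le> exp (1::real)" by simp
  have C1: "1 \<le> C" unfolding C_def using m1 e1 mult_mono[of 1 "exp 1" 1 "m powr (\<alpha> + 1)"] by simp
  have Ce: "exp 1 \<le> C" unfolding C_def using m1 by simp
  show thesis
  proof (rule that)
    show "1 \<le> C" by fact
    show "1 \<le> \<lceil>m * t0\<rceil>" using t0(1) assms mult_mono[of 1 m 1 "real_of_int t0"] by simp
    have big: "t0 \<le> t" "m * t0 \<le> t" if "\<lceil>m * t0\<rceil> \<le> t" for t
    proof -
      show "m * t0 \<le> t" using that by linarith
      moreover have "t0 \<le> m * t0" using assms t0(1) mult_right_mono[of 1 m "real_of_int t0"] by simp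
      ultimately show "t0 \<le> t" by linarith
    qed
    show "0 < pmf F t" if "\<lceil>m * t0\<rceil> \<le> t" for t using big[OF that] t0 by auto
    fix s t :: int assume t: "\<lceil>m * t0\<rceil> \<le> t" and s: "real_of_int t / m \<le> real_of_int s"
    have tt: "t0 \<le> t" "m * t0 \<le> t" using big[OF t] by auto
    have pt: "0 < pmf F t" using t0 tt by auto
    show "pmf F s \<le> C * pmf F t"
    proof (cases "t \<le> s")
      case True
      have "pmf F s \<le> exp 1 * (s / t) powr (-\<alpha> + 1) * pmf F t" using up[OF tt(1) True] .
      also have "\<dots> \<le> exp 1 * 1 * pmf F t"
      proof (intro mult_right_mono mult_left_mono)
        have "1 \<le> real_of_int s / real_of_int t" using True tt t0(1) by simp
        moreover from this have "(s / t) powr 0 = 1" by (subst powr_zero_eq_one) (auto simp del: of_int_0_less_iff)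
        ultimately show "(s / t) powr (-\<alpha> + 1) \<le> 1"
          using \<alpha>_gt_1 powr_mono[of "-\<alpha> + 1" 0 "s / t"] by linarith
      qed auto
      also have "\<dots> \<le> C * pmf F t" using Ce pt by simp
      finally show ?thesis .
    next
      case False
      have "real_of_int t \<le> m * real_of_int s" using s assms by (simp add: field_simps)
      then have "m * real_of_int t0 \<le> m * real_of_int s" using tt by linarith
      then have "real_of_int t0 \<le> real_of_int s"
        by (rule mult_left_le_imp_le) (use assms in linarith)
      then have s0: "t0 \<le> s" by simp
      have "exp (-1) * m powr (-\<alpha> - 1) * pmf F s \<le> exp (-1) * (t / s) powr (-\<alpha> - 1) * pmf F s"
      proof (intro mult_right_mono mult_left_mono)
        have "t / s \<le> m" using s s0 t0(1) assms by (simp add: field_simps)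
        moreover have "0 < t / s" using s0 t0(1) tt by simp
        ultimately show "m powr (-\<alpha> - 1) \<le> (t / s) powr (-\<alpha> - 1)"
          using \<alpha>_gt_1 by (intro powr_mono2') auto
      qed auto
      also have "\<dots> \<le> pmf F t" using low[OF s0] False by simp
      finally have "exp 1 * m powr (\<alpha> + 1) * (exp (-1) * m powr (-\<alpha> - 1) * pmf F s) \<le> C * pmf F t"
        unfolding C_def using assms by (intro mult_left_mono) auto
      also have "exp 1 * m powr (\<alpha> + 1) * (exp (-1) * m powr (-\<alpha> - 1) * pmf F s)
          = (exp 1 * exp (-1)) * (m powr (\<alpha> + 1) * m powr (-\<alpha> - 1)) * pmf F s"
        by (simp only: mult_ac)
      also have "\<dots> = pmf F s"
        using assms by (simp flip: exp_add powr_add)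
      finally show ?thesis .
    qed
  qed
qed

lemma pmf_shift:
  "(\<lambda>t::nat. pmf F (int t - k) / pmf F (int t)) \<longlonglongrightarrow> 1"
proof -
  have "(\<lambda>t::nat. ((real t - real_of_int k) / real t) powr (-\<alpha>)
      * (L (real t - real_of_int k) / L (real t))) \<longlonglongrightarrow> 1 powr (-\<alpha>) * 1"
  proof (intro tendsto_mult tendsto_powr slowly_varying_shift[OF L] tendsto_const)
    show "(\<lambda>t::nat. (real t - real_of_int k) / real t) \<longlonglongrightarrow> 1" by real_asymp
  qed simp
  moreover have "\<forall>\<^sub>F t::nat in sequentially. 1 + \<bar>real_of_int k\<bar> \<le> real t"
    by real_asymp
  then have "\<forall>\<^sub>F t::nat in sequentially. ((real t - real_of_int k) / real t) powr (-\<alpha>)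
      * (L (real t - real_of_int k) / L (real t)) = pmf F (int t - k) / pmf F (int t)"
  proof eventually_elim
    case (elim t)
    have "1 \<le> int t" "1 \<le> int t - k" "0 < real t - real_of_int k" "0 < real t" using elim by linarith+
    then show ?case by (simp add: pmf_eq powr_divide)
  qed
  ultimately show ?thesis by (auto intro: Lim_transform_eventually)
qed

end

section \<open>Convolution powers: tilting, concentration and the Green function\<close>

text \<open>The convolution powers are defined on laws, so that inductions on n need no probability
  space; one step is drawn before the rest, which makes each mass an average over that step.\<close>

primrec sum_pmf :: "int pmf \<Rightarrow> nat \<Rightarrow> int pmf" where
  "sum_pmf F 0 = return_pmf 0"
| "sum_pmf F (Suc n) = bind_pmf F (\<lambda>k. map_pmf ((+) k) (sum_pmf F n))"

lemma pmf_map_plus: "pmf (map_pmf ((+) k) G) (t::int) = pmf G (t - k)"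
  using pmf_map_inj'[of "(+) k" G "t - k"] by (simp add: inj_def)

lemma pmf_sum_Suc:
  "pmf (sum_pmf F (Suc n)) t = measure_pmf.expectation F (\<lambda>k. pmf (sum_pmf F n) (t - k))"
  by (simp add: pmf_bind pmf_map_plus)

lemma integral_pmf_count_space:
  "measure_pmf.expectation F f = (\<integral>k. pmf F k * f k \<partial>count_space UNIV)" for f :: "'a \<Rightarrow> real"
  unfolding measure_pmf_eq_density by (subst integral_density) auto

text \<open>The substitution j = t - k in a convolution exchanges the single step with the remaining
  sum, so that a bound on the masses of \<open>F\<close> can be taken out.\<close>

lemma integral_pmf_reflect:
  fixes f :: "int \<Rightarrow> real"
  shows "measure_pmf.expectation F (\<lambda>k. f k * pmf G (t - k))
       = measure_pmf.expectation G (\<lambda>j. f (t - j) * pmf F (t - j))"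
proof -
  have "bij_betw (\<lambda>j. t - j) UNIV (UNIV :: int set)"
    by (rule bij_betwI[of _ _ _ "\<lambda>j. t - j"]) auto
  from integral_bij_count_space[OF this, of "\<lambda>k. pmf F k * (f k * pmf G (t - k))"]
  show ?thesis by (simp add: integral_pmf_count_space mult_ac)
qed

lemma integrable_pmf_bounded:
  fixes f :: "int \<Rightarrow> real"
  assumes "\<And>k. \<bar>f k\<bar> \<le> c"
  shows "integrable (measure_pmf F) f"
  by (rule measure_pmf.integrable_const_bound[of _ c]) (use assms in auto)

text \<open>The assumption \<open>0 \<le> c\<close> covers a non-integrable \<open>f\<close>, whose
  expectation is 0 by convention.\<close>

lemma pmf_expectation_le:
  fixes f :: "int \<Rightarrow> real"
  assumes "\<And>k. f k \<le> c" "0 \<le> c"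
  shows "measure_pmf.expectation F f \<le> c"
proof (cases "integrable (measure_pmf F) f")
  case True
  then have "measure_pmf.expectation F f \<le> measure_pmf.expectation F (\<lambda>_. c)"
    by (rule integral_mono) (use assms in auto)
  then show ?thesis by simp
qed (use assms in \<open>simp add: not_integrable_integral_eq\<close>)

text \<open>Exponential tilting of the steps in \<open>K\<close>; the remaining steps cost at most \<open>b n\<close> each.\<close>

lemma pmf_sum_tilt:
  fixes l c :: real and K :: "int set"
  assumes K: "\<And>k. k \<in> K \<Longrightarrow> exp (l * k) \<le> c"
    and b: "\<And>n t. measure_pmf.expectation F (\<lambda>k. indicator (- K) k * pmf (sum_pmf F n) (t - k)) \<le> b n"
  shows "pmf (sum_pmf F n) t \<le>
      exp (- l * t) * measure_pmf.expectation F (\<lambda>k. indicator K k * exp (l * k)) ^ n + (\<Sum>j<n. b j)"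
proof (induction n arbitrary: t)
  case 0
  show ?case by (auto simp: indicator_def)
next
  case (Suc n)
  define A where "A = measure_pmf.expectation F (\<lambda>k. indicator K k * exp (l * k))"
  define D where "D = (\<Sum>j<n. b j)"
  have b0: "0 \<le> b j" for j
    by (rule order_trans[OF _ b[of j 0]]) (auto intro!: integral_nonneg_AE)
  have D0: "0 \<le> D" unfolding D_def using b0 by (auto intro: sum_nonneg)
  have A0: "0 \<le> A" unfolding A_def by (auto intro!: integral_nonneg_AE)
  have int: "integrable (measure_pmf F) (\<lambda>k. indicator K k * exp (l * k))"
    by (rule integrable_pmf_bounded[of _ "\<bar>c\<bar>"]) (use K in \<open>force simp: indicator_def\<close>)
  have intb: "integrable (measure_pmf F) (\<lambda>k. indicator J k * pmf (sum_pmf F n) (t - k))" for J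
    by (rule integrable_pmf_bounded[of _ 1]) (auto simp: indicator_def pmf_le_1)
  have "pmf (sum_pmf F (Suc n)) t =
      measure_pmf.expectation F (\<lambda>k. indicator K k * pmf (sum_pmf F n) (t - k) + indicator (- K) k * pmf (sum_pmf F n) (t - k))"
    unfolding pmf_sum_Suc by (intro Bochner_Integration.integral_cong) (auto simp: indicator_def)
  also have "\<dots> = measure_pmf.expectation F (\<lambda>k. indicator K k * pmf (sum_pmf F n) (t - k))
      + measure_pmf.expectation F (\<lambda>k. indicator (- K) k * pmf (sum_pmf F n) (t - k))"
    by (rule Bochner_Integration.integral_add[OF intb intb])
  \<comment> \<open>The factor exp (l k) carries the bound from t - k to t, and integrating it over
    \<open>K\<close> yields one more factor \<open>A\<close>. The earlier error \<open>D\<close> is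
    averaged with total weight at most one, so errors add up and do not multiply.\<close>
  also have "\<dots> \<le> measure_pmf.expectation F (\<lambda>k. exp (- l * t) * A ^ n * (indicator K k * exp (l * k)) + D) + b n"
  proof (intro add_mono b integral_mono intb)
    show "integrable (measure_pmf F) (\<lambda>k. exp (- l * t) * A ^ n * (indicator K k * exp (l * k)) + D)"
      using int by auto
    fix k
    have "pmf (sum_pmf F n) (t - k) \<le> exp (- l * (t - k)) * A ^ n + D"
      using Suc.IH[of "t - k"] by (simp add: A_def D_def)
    also have "\<dots> = exp (- l * t) * A ^ n * exp (l * k) + D"
      by (simp add: algebra_simps flip: exp_add)
    finally show "indicator K k * pmf (sum_pmf F n) (t - k) \<le> exp (- l * t) * A ^ n * (indicator K k * exp (l * k)) + D"
      using D0 by (auto simp: indicator_def)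
  qed
  also have "\<dots> = exp (- l * t) * A ^ n * A + D + b n"
    using int by (simp add: A_def)
  finally show ?case by (simp add: A_def D_def mult_ac)
qed

text \<open>\<open>F\<close> has a uniform component of weight w = card B * q on \<open>B\<close>.
  Once a step is drawn from it, no point carries more than 1 / card B; with probability (1 - w) ^ n
  this never happens. The induction expresses this without a coupling: if D bounds the masses at
  time n, then (1 - w) * D + q bounds those at time n + 1, and 1 / card B is the fixed point of this
  recursion.\<close>

lemma pmf_sum_concentration:
  fixes q :: real
  assumes "finite B" "B \<noteq> {}" "\<And>k. k \<in> B \<Longrightarrow> q \<le> pmf F k" "0 \<le> q"
  shows "pmf (sum_pmf F n) t \<le> 1 / card B + (1 - card B * q) ^ n"
proof (induction n arbitrary: t)
  case 0
  then show ?case using pmf_le_1[of "sum_pmf F 0" t] assms(1) by (simp add: add_increasing)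
next
  case (Suc n)
  define w where "w = card B * q"
  define D where "D = 1 / card B + (1 - w) ^ n"
  define g where "g k = pmf (sum_pmf F n) (t - k)" for k
  have card: "0 < card B" using assms by (simp add: card_gt_0_iff)
  have gD: "g k \<le> D" for k using Suc.IH by (simp add: g_def D_def w_def)
  have g0: "0 \<le> g k" "g k \<le> 1" for k by (auto simp: g_def pmf_le_1)
  have D0: "0 \<le> D" using gD[of 0] g0[of 0] by simp
  \<comment> \<open>These are masses at distinct points. Hence the bound \<open>D\<close> cannot be
    attained all over \<open>B\<close>: the deficits D - g k add up to at least card B * D -
    1.\<close>
  have sumB: "(\<Sum>k\<in>B. g k) \<le> 1"
  proof -
    have "(\<Sum>k\<in>B. g k) = (\<Sum>j\<in>(\<lambda>k. t - k) ` B. pmf (sum_pmf F n) j)"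
      by (subst sum.reindex) (auto simp: inj_on_def g_def)
    also have "\<dots> = measure (measure_pmf (sum_pmf F n)) ((\<lambda>k. t - k) ` B)"
      using assms(1) by (simp add: measure_measure_pmf_finite)
    finally show ?thesis by simp
  qed
  have "q * (card B * D - 1) \<le> q * (\<Sum>k\<in>B. D - g k)"
    using sumB assms(4) by (intro mult_left_mono) (auto simp: sum_subtractf)
  also have "\<dots> = (\<Sum>k\<in>B. q * (D - g k))" by (rule sum_distrib_left)
  also have "\<dots> \<le> (\<Sum>k\<in>B. (D - g k) * pmf F k)"
    using gD assms(3) by (intro sum_mono) (simp add: mult.commute[of q] mult_left_mono)
  also have "\<dots> = (\<Sum>k\<in>B. (indicator B k * (D - g k)) * pmf F k)"
    by (intro sum.cong) (auto simp: indicator_def)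
  also have "\<dots> = measure_pmf.expectation F (\<lambda>k. indicator B k * (D - g k))"
    using assms(1) by (subst integral_measure_pmf_real[of B]) (auto simp: indicator_def)
  also have "\<dots> \<le> measure_pmf.expectation F (\<lambda>k. D - g k)"
  proof (intro integral_mono)
    show "integrable (measure_pmf F) (\<lambda>k. indicator B k * (D - g k))"
      by (rule integrable_pmf_bounded[of _ D]) (simp add: indicator_def gD g0 D0)
    show "integrable (measure_pmf F) (\<lambda>k. D - g k)"
      by (rule integrable_pmf_bounded[of _ D]) (simp add: gD g0)
  qed (simp add: indicator_def gD)
  also have "\<dots> = D - pmf (sum_pmf F (Suc n)) t"
    unfolding pmf_sum_Suc g_def
    by (subst Bochner_Integration.integral_diff)
       (auto intro!: integrable_pmf_bounded[of _ 1] simp: pmf_le_1)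
  finally have "pmf (sum_pmf F (Suc n)) t \<le> D - q * (card B * D - 1)" by simp
  also have "\<dots> = (1 - w) * D + q" by (simp add: w_def algebra_simps)
  also have "\<dots> = 1 / card B + (1 - w) ^ Suc n"
    using card by (simp add: D_def w_def field_simps)
  finally show ?case by (simp add: w_def)
qed

text \<open>A maximum principle: away from the origin, the Green function is an average of its own
  values.\<close>

lemma pmf_sum_Green_le:
  "(\<Sum>n\<le>m. pmf (sum_pmf F n) t) \<le> (\<Sum>n\<le>m. pmf (sum_pmf F n) 0)"
proof (induction m arbitrary: t)
  case 0
  then show ?case by (simp add: indicator_def)
next
  case (Suc m)
  show ?case
  proof (cases "t = 0")
    case False
    \<comment> \<open>Off the origin the term n = 0 vanishes, and conditioning on one step leaves
      the sum up to m. The induction therefore runs over the truncation level, and no convergence is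
      presupposed.\<close>
    have "(\<Sum>n\<le>Suc m. pmf (sum_pmf F n) t) = (\<Sum>n\<le>m. pmf (sum_pmf F (Suc n)) t)"
      using False by (subst sum.atMost_Suc_shift) simp
    also have "\<dots> = measure_pmf.expectation F (\<lambda>k. \<Sum>n\<le>m. pmf (sum_pmf F n) (t - k))"
      unfolding pmf_sum_Suc
      by (subst Bochner_Integration.integral_sum)
         (auto intro!: integrable_pmf_bounded[of _ 1] simp: pmf_le_1)
    also have "\<dots> \<le> (\<Sum>n\<le>m. pmf (sum_pmf F n) 0)"
      by (intro pmf_expectation_le Suc.IH) (auto intro: sum_nonneg)
    also have "\<dots> \<le> (\<Sum>n\<le>Suc m. pmf (sum_pmf F n) 0)" by simp
    finally show ?thesis .
  qed simp
qed

text \<open>After reflection the remaining sum is averaged out, and only the largest mass of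
  \<open>F\<close> outside \<open>K\<close> survives.\<close>

lemma expectation_tail_le:
  fixes K :: "int set" and c :: real
  assumes "\<And>k. k \<notin> K \<Longrightarrow> pmf F k \<le> c" "0 \<le> c"
  shows "measure_pmf.expectation F (\<lambda>k. indicator (- K) k * pmf G (t - k)) \<le> c"
proof -
  have "measure_pmf.expectation F (\<lambda>k. indicator (- K) k * pmf G (t - k))
      = measure_pmf.expectation G (\<lambda>j. indicator (- K) (t - j) * pmf F (t - j))"
    by (rule integral_pmf_reflect)
  also have "\<dots> \<le> c"
    by (rule pmf_expectation_le) (simp_all add: indicator_def assms)
  finally show ?thesis .
qed

text \<open>The opposite trade: the probability of leaving \<open>K\<close> is kept and the
  remaining sum contributes its concentration. This serves for the left tail, where probabilities
  but no single masses are controlled.\<close>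

lemma expectation_tail_le':
  fixes K :: "int set" and c :: real
  assumes "\<And>t. pmf G t \<le> c"
  shows "measure_pmf.expectation F (\<lambda>k. indicator (- K) k * pmf G (t - k))
    \<le> measure_pmf.prob F (- K) * c"
proof -
  have "measure_pmf.expectation F (\<lambda>k. indicator (- K) k * pmf G (t - k))
      \<le> measure_pmf.expectation F (\<lambda>k. indicator (- K) k * c)"
    using assms order_trans[OF pmf_nonneg assms]
    by (intro integral_mono integrable_pmf_bounded[of _ 1] integrable_pmf_bounded[of _ c])
       (auto simp: indicator_def pmf_le_1)
  then show ?thesis by simp
qed

lemma pmf_dominated_convergence:
  fixes s :: "nat \<Rightarrow> 'a \<Rightarrow> real"
  assumes w: "integrable (measure_pmf P) w"
    and lim: "\<And>x. (\<lambda>i. s i x) \<longlonglongrightarrow> f x"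
    and bound: "\<forall>\<^sub>F i in sequentially. \<forall>x. \<bar>s i x\<bar> \<le> w x"
  shows "(\<lambda>i. measure_pmf.expectation P (s i)) \<longlonglongrightarrow> measure_pmf.expectation P f"
proof -
  obtain N where N: "\<And>i x. N \<le> i \<Longrightarrow> \<bar>s i x\<bar> \<le> w x"
    using bound by (auto simp: eventually_sequentially)
  have "(\<lambda>i. measure_pmf.expectation P (s (i + N))) \<longlonglongrightarrow> measure_pmf.expectation P f"
    by (rule integral_dominated_convergence[where w = w])
       (use w N in \<open>auto intro!: AE_I2 LIMSEQ_ignore_initial_segment lim\<close>)
  then show ?thesis by (rule LIMSEQ_offset)
qed

lemma LIMSEQ_int_shift:
  fixes f :: "int \<Rightarrow> 'a :: topological_space"
  assumes "(\<lambda>t::nat. f (int t)) \<longlonglongrightarrow> l"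
  shows "(\<lambda>t::nat. f (int t - k)) \<longlonglongrightarrow> l"
proof -
  have "filterlim (\<lambda>t::nat. nat (int t - k)) at_top at_top"
    unfolding filterlim_at_top
  proof
    fix Z :: nat
    show "\<forall>\<^sub>F t in sequentially. Z \<le> nat (int t - k)"
      using eventually_ge_at_top[of "Z + nat \<bar>k\<bar>"] by eventually_elim linarith
  qed
  from filterlim_compose[OF assms this]
  have "(\<lambda>t::nat. f (int (nat (int t - k)))) \<longlonglongrightarrow> l" .
  moreover have "\<forall>\<^sub>F t::nat in sequentially. f (int (nat (int t - k))) = f (int t - k)"
    using eventually_ge_at_top[of "nat \<bar>k\<bar>"]
  proof eventually_elim
    case (elim t)
    then have "int (nat (int t - k)) = int t - k" by linarith
    then show ?case by simp
  qed
  ultimately show ?thesis by (rule Lim_transform_eventually)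
qed

section \<open>One large jump for a fixed number of summands\<close>

context regvar_pmf begin

text \<open>Either the last step or the sum of the others makes the large jump.\<close>

lemma pmf_sum_asymp:
  "(\<lambda>t::nat. pmf (sum_pmf F n) (int t) / pmf F (int t)) \<longlonglongrightarrow> real n"
proof (induction n)
  case 0
  have "\<forall>\<^sub>F t::nat in sequentially. pmf (sum_pmf F 0) (int t) / pmf F (int t) = 0"
    using eventually_ge_at_top[of 1] by eventually_elim (simp add: indicator_def)
  then show ?case by (simp add: tendsto_eventually)
next
  case (Suc n)
  define u where "u = pmf (sum_pmf F n)"
  obtain C t0 where C: "1 \<le> C" "1 \<le> t0" and pos: "\<And>t. t0 \<le> t \<Longrightarrow> 0 < pmf F t"
    and dec: "\<And>s t::int. t0 \<le> t \<Longrightarrow> real_of_int t / 2 \<le> real_of_int s \<Longrightarrow> pmf F s \<le> C * pmf F t"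
    by (rule pmf_almost_decreasing[of 2]) (simp, blast)
  have "\<forall>\<^sub>F t::nat in sequentially. u (int t) / pmf F (int t) < real n + 1"
    by (rule order_tendstoD(2)[OF Suc.IH[folded u_def]]) simp
  then obtain s0 :: nat where s0: "\<And>t. s0 \<le> t \<Longrightarrow> u (int t) / pmf F (int t) < real n + 1"
    by (auto simp: eventually_sequentially)
  have u_le: "u s \<le> (real n + 1) * pmf F s" if "t0 + int s0 \<le> s" for s :: int
  proof -
    have "0 < pmf F s" using pos that by simp
    moreover have "u s / pmf F s < real n + 1" using s0[of "nat s"] that C by simp
    ultimately show ?thesis by (simp add: divide_less_eq)
  qed
  \<comment> \<open>Cutting at t / 2 makes the part that jumps, t - k in \<open>s1\<close> and t - j
    in \<open>s2\<close>, at least t / 2. There almost monotonicity supplies constant dominating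
    functions, and the two pieces converge to n and to 1.\<close>
  define s1 where "s1 = (\<lambda>(t::nat) k. indicator {k. 2 * k \<le> int t} k * u (int t - k) / pmf F (int t))"
  define s2 where "s2 = (\<lambda>(t::nat) j. indicator {j. 2 * j < int t} j * pmf F (int t - j) / pmf F (int t))"
  have lim1: "(\<lambda>t. measure_pmf.expectation F (s1 t)) \<longlonglongrightarrow> measure_pmf.expectation F (\<lambda>_. real n)"
  proof (rule pmf_dominated_convergence[where w = "\<lambda>_. (real n + 1) * C"])
    fix k
    have "(\<lambda>t::nat. u (int t - k) / pmf F (int t - k) * (pmf F (int t - k) / pmf F (int t))) \<longlonglongrightarrow> real n * 1"
      by (intro tendsto_mult LIMSEQ_int_shift[of "\<lambda>x. u x / pmf F x"] pmf_shift) (use Suc.IH in \<open>simp add: u_def\<close>)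
    moreover have "\<forall>\<^sub>F t::nat in sequentially.
        u (int t - k) / pmf F (int t - k) * (pmf F (int t - k) / pmf F (int t)) = s1 t k"
      using eventually_ge_at_top[of "2 * nat \<bar>k\<bar> + nat t0"]
    proof eventually_elim
      case (elim t)
      have "0 < pmf F (int t - k)" by (rule pos) (use elim in linarith)
      moreover have "2 * k \<le> int t" using elim by linarith
      ultimately show ?case by (simp add: s1_def)
    qed
    ultimately show "(\<lambda>t. s1 t k) \<longlonglongrightarrow> real n" by (auto intro: Lim_transform_eventually)
  next
    show "\<forall>\<^sub>F t in sequentially. \<forall>k. \<bar>s1 t k\<bar> \<le> (real n + 1) * C"
      using eventually_ge_at_top[of "nat (2 * (t0 + int s0))"]
    proof eventually_elim
      case (elim t)
      then have big: "2 * (t0 + int s0) \<le> int t" by (simp add: nat_le_iff)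
      have pt: "0 < pmf F (int t)" using pos big C by simp
      have "\<bar>s1 t k\<bar> \<le> (real n + 1) * C" for k
      proof (cases "2 * k \<le> int t")
        case True
        have "u (int t - k) \<le> (real n + 1) * pmf F (int t - k)"
          by (rule u_le) (use True big in \<open>simp; linarith\<close>)
        also have "\<dots> \<le> (real n + 1) * (C * pmf F (int t))"
          using True big C by (intro mult_left_mono dec) (auto simp: field_simps)
        finally show ?thesis using True pt by (simp add: s1_def u_def divide_le_eq mult_ac)
      qed (use C in \<open>simp add: s1_def\<close>)
      then show ?case by blast
    qed
  qed simp
  have lim2: "(\<lambda>t. measure_pmf.expectation (sum_pmf F n) (s2 t)) \<longlonglongrightarrow> measure_pmf.expectation (sum_pmf F n) (\<lambda>_. 1)"
  proof (rule pmf_dominated_convergence[where w = "\<lambda>_. C"])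
    fix j
    have "\<forall>\<^sub>F t::nat in sequentially. pmf F (int t - j) / pmf F (int t) = s2 t j"
      using eventually_ge_at_top[of "2 * nat \<bar>j\<bar> + 1"]
    proof eventually_elim
      case (elim t)
      then have "2 * j < int t" by linarith
      then show ?case by (simp add: s2_def)
    qed
    with pmf_shift[of j] show "(\<lambda>t. s2 t j) \<longlonglongrightarrow> 1" by (rule Lim_transform_eventually)
  next
    show "\<forall>\<^sub>F t in sequentially. \<forall>j. \<bar>s2 t j\<bar> \<le> C"
      using eventually_ge_at_top[of "nat t0"]
    proof eventually_elim
      case (elim t)
      have pt: "0 < pmf F (int t)" using pos elim C by simp
      have "\<bar>s2 t j\<bar> \<le> C" for j
      proof (cases "2 * j < int t")
        case True
        have "pmf F (int t - j) \<le> C * pmf F (int t)"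
          using True elim C by (intro dec) (auto simp: field_simps)
        then show ?thesis using True pt by (simp add: s2_def divide_le_eq mult_ac)
      qed (use C in \<open>simp add: s2_def\<close>)
      then show ?case by blast
    qed
  qed simp
  have "pmf (sum_pmf F (Suc n)) (int t) / pmf F (int t)
      = measure_pmf.expectation F (s1 t) + measure_pmf.expectation (sum_pmf F n) (s2 t)" for t :: nat
  proof -
    have int: "integrable (measure_pmf F) (\<lambda>k. indicator J k * u (int t - k))" for J :: "int set"
      by (rule integrable_pmf_bounded[of _ 1]) (auto simp: indicator_def u_def pmf_le_1)
    have "pmf (sum_pmf F (Suc n)) (int t) = measure_pmf.expectation F
        (\<lambda>k. indicator {k. 2 * k \<le> int t} k * u (int t - k) + indicator {k. int t < 2 * k} k * u (int t - k))"
      unfolding pmf_sum_Suc by (intro Bochner_Integration.integral_cong) (auto simp: indicator_def u_def)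
    also have "\<dots> = measure_pmf.expectation F (\<lambda>k. indicator {k. 2 * k \<le> int t} k * u (int t - k))
        + measure_pmf.expectation F (\<lambda>k. indicator {k. int t < 2 * k} k * u (int t - k))"
      by (rule Bochner_Integration.integral_add[OF int int])
    also have "measure_pmf.expectation F (\<lambda>k. indicator {k. int t < 2 * k} k * u (int t - k))
        = measure_pmf.expectation (sum_pmf F n) (\<lambda>j. indicator {k. int t < 2 * k} (int t - j) * pmf F (int t - j))"
      unfolding u_def by (rule integral_pmf_reflect)
    also have "\<dots> = measure_pmf.expectation (sum_pmf F n) (\<lambda>j. indicator {j. 2 * j < int t} j * pmf F (int t - j))"
      by (intro Bochner_Integration.integral_cong) (auto simp: indicator_def)
    finally show ?thesis by (simp add: s1_def s2_def add_divide_distrib)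
  qed
  then show ?case using tendsto_add[OF lim1 lim2] by (simp add: add.commute)
qed

end

section \<open>Exponential moments of truncated steps\<close>

text \<open>z powr k * exp (- z) is largest at z = k. The bound turns exponential decay into decay
  of any prescribed power.\<close>

lemma exp_neg_le_powr:
  fixes z k :: real
  assumes "0 < z" "0 < k"
  shows "exp (- z) \<le> k powr k * z powr (- k)"
proof -
  have "ln (z / k) \<le> z / k - 1" using assms by (intro ln_le_minus_one) auto
  then have "k * ln (z / k) \<le> k * (z / k - 1)" using assms by (intro mult_left_mono) auto
  then have "- z \<le> k * ln k - k * ln z" using assms by (simp add: ln_div algebra_simps)
  then have "exp (- z) \<le> exp (k * ln k - k * ln z)" by simp
  also have "\<dots> = k powr k * z powr (- k)"
    using assms by (simp add: powr_def flip: exp_add)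
  finally show ?thesis .
qed

text \<open>The first-order remainder weakened to an order k \<le> 1, as only such moments are at
  hand when \<alpha> \<le> 2. Negative x contribute nothing, which is why the left tail stays out of
  that case.\<close>

lemma exp_minus_one_le:
  fixes x k :: real
  assumes "0 < k" "k \<le> 1"
  shows "exp x - 1 \<le> max x 0 powr k * exp (max x 0)"
proof (cases "x \<le> 0")
  case False
  have "exp x - 1 \<le> x powr k * exp x"
  proof (cases "1 \<le> x")
    case True
    then have "1 * exp x \<le> x powr k * exp x"
      using assms by (intro mult_right_mono ge_one_powr_ge_zero) auto
    then show ?thesis by (smt (verit) mult_1)
  next
    case x1: False
    have "1 - exp (- x) \<le> x" using exp_ge_add_one_self[of "- x"] by linarith
    also have "x \<le> x powr k"
      using powr_mono'[of k 1 x] assms x1 False by simp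
    finally have "(1 - exp (- x)) * exp x \<le> x powr k * exp x" by (intro mult_right_mono) auto
    then show ?thesis by (simp add: left_diff_distrib flip: exp_add)
  qed
  then show ?thesis using False by (simp add: max_def)
qed simp

text \<open>Interpolation between a quadratic bound, used for small x, and a linear one, used for
  large x.\<close>

lemma exp_minus_one_minus_id_le:
  fixes x k :: real
  assumes "1 \<le> k" "k \<le> 2"
  shows "exp x - 1 - x \<le> \<bar>x\<bar> powr k * exp (max x 0)"
proof -
  have ex: "exp x - 1 \<le> x * exp x"
  proof -
    have "(1 - exp (- x)) * exp x \<le> x * exp x"
      using exp_ge_add_one_self[of "- x"] by (intro mult_right_mono) auto
    then show ?thesis by (simp add: left_diff_distrib flip: exp_add)
  qed
  have sq: "exp x - 1 - x \<le> \<bar>x\<bar> powr 2 * exp (max x 0)"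
  proof -
    have "exp x - 1 - x \<le> x * (exp x - 1)" using ex by (simp add: algebra_simps)
    also have "\<dots> \<le> \<bar>x\<bar> * (\<bar>x\<bar> * exp (max x 0))"
    proof (cases "0 \<le> x")
      case True
      then show ?thesis using ex by (intro mult_mono) auto
    next
      case False
      have "x * (exp x - 1) = \<bar>x\<bar> * (1 - exp x)" using False by (simp add: algebra_simps)
      also have "\<dots> \<le> \<bar>x\<bar> * (\<bar>x\<bar> * exp (max x 0))"
      proof (rule mult_left_mono)
        have "1 - exp x \<le> - x" using exp_ge_add_one_self[of x] by linarith
        then show "1 - exp x \<le> \<bar>x\<bar> * exp (max x 0)" using False by simp
      qed simp
      finally show ?thesis .
    qed
    finally show ?thesis by (simp add: power2_eq_square mult_ac)
  qed
  show ?thesis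
  proof (cases "\<bar>x\<bar> \<le> 1")
    case True
    have "\<bar>x\<bar> powr 2 \<le> \<bar>x\<bar> powr k"
      using True assms by (intro powr_mono') auto
    then have "\<bar>x\<bar> powr 2 * exp (max x 0) \<le> \<bar>x\<bar> powr k * exp (max x 0)"
      by (intro mult_right_mono) auto
    with sq show ?thesis by linarith
  next
    case False
    then have x: "\<bar>x\<bar> \<le> \<bar>x\<bar> powr k" using assms powr_mono[of 1 k "\<bar>x\<bar>"] by simp
    have "exp x - 1 - x \<le> \<bar>x\<bar> * exp (max x 0)"
    proof (cases "0 \<le> x")
      case True
      then have "1 * exp x \<le> x * exp x" using False by (intro mult_right_mono) auto
      then have "exp x - 1 - x \<le> x * exp x" using True by linarith
      with True show ?thesis by simp
    qed auto
    also have "\<dots> \<le> \<bar>x\<bar> powr k * exp (max x 0)" using x by (intro mult_right_mono) auto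
    finally show ?thesis .
  qed
qed

lemma integrable_of_integrable_powr:
  fixes Z :: "int \<Rightarrow> real"
  assumes "1 \<le> k" "integrable (measure_pmf F) (\<lambda>x. \<bar>Z x\<bar> powr k)"
  shows "integrable (measure_pmf F) Z"
proof (rule Bochner_Integration.integrable_bound)
  show "integrable (measure_pmf F) (\<lambda>x. 1 + \<bar>Z x\<bar> powr k)" using assms(2) by simp
  have "\<bar>z\<bar> \<le> 1 + \<bar>z\<bar> powr k" for z :: real
  proof (cases "\<bar>z\<bar> \<le> 1")
    case True
    moreover have "0 \<le> \<bar>z\<bar> powr k" by simp
    ultimately show ?thesis by linarith
  next
    case False
    then show ?thesis using assms(1) powr_mono[of 1 k "\<bar>z\<bar>"] by simp
  qed
  then show "AE x in measure_pmf F. norm (Z x) \<le> norm (1 + \<bar>Z x\<bar> powr k)"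
    by (intro AE_I2) (simp add: abs_of_nonneg add_nonneg_nonneg)
qed simp

lemma truncated_exp_moment_low:
  fixes Z :: "int \<Rightarrow> real"
  assumes "0 < k" "k \<le> 1" "integrable (measure_pmf F) (\<lambda>x. max (Z x) 0 powr k)" "0 \<le> l" "0 \<le> y"
  shows "measure_pmf.expectation F (\<lambda>x. indicator {x. Z x \<le> y} x * exp (l * Z x))
    \<le> 1 + measure_pmf.expectation F (\<lambda>x. max (Z x) 0 powr k) * l powr k * exp (l * y)"
proof -
  have "measure_pmf.expectation F (\<lambda>x. indicator {x. Z x \<le> y} x * exp (l * Z x))
    \<le> measure_pmf.expectation F (\<lambda>x. 1 + max (Z x) 0 powr k * (l powr k * exp (l * y)))"
  proof (intro integral_mono)
    have "exp (l * Z x) \<le> exp (l * y)" if "Z x \<le> y" for x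
      using that assms by (simp add: mult_left_mono)
    then show "integrable (measure_pmf F) (\<lambda>x. indicator {x. Z x \<le> y} x * exp (l * Z x))"
      by (intro integrable_pmf_bounded[of _ "exp (l * y)"]) (auto simp: indicator_def)
    show "integrable (measure_pmf F) (\<lambda>x. 1 + max (Z x) 0 powr k * (l powr k * exp (l * y)))"
      using assms(3) by simp
    fix x
    show "indicator {x. Z x \<le> y} x * exp (l * Z x) \<le> 1 + max (Z x) 0 powr k * (l powr k * exp (l * y))"
    proof (cases "Z x \<le> y")
      case True
      have "exp (l * Z x) - 1 \<le> max (l * Z x) 0 powr k * exp (max (l * Z x) 0)"
        by (rule exp_minus_one_le[OF assms(1,2)])
      also have "max (l * Z x) 0 = l * max (Z x) 0"
        using assms(4) max_mult_distrib_left[of l "Z x" 0] by simp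
      also have "(l * max (Z x) 0) powr k * exp (l * max (Z x) 0) \<le> (l * max (Z x) 0) powr k * exp (l * y)"
        using True assms(4,5) by (intro mult_left_mono) (auto intro: mult_left_mono)
      also have "\<dots> = max (Z x) 0 powr k * (l powr k * exp (l * y))"
        using assms(4) by (simp add: powr_mult)
      finally show ?thesis using True by simp
    qed (simp add: add_nonneg_nonneg)
  qed
  also have "\<dots> = 1 + measure_pmf.expectation F (\<lambda>x. max (Z x) 0 powr k) * l powr k * exp (l * y)"
    using assms(3) by simp
  finally show ?thesis .
qed

text \<open>Although the left side is truncated, the full mean of \<open>Z\<close> appears: beyond y
  \<ge> 0 the majorant is non-negative and may be included. \<open>Z\<close> is left general so that
  it can be the step or its negative.\<close>

lemma truncated_exp_moment_high:
  fixes Z :: "int \<Rightarrow> real"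
  assumes "1 \<le> k" "k \<le> 2" "integrable (measure_pmf F) (\<lambda>x. \<bar>Z x\<bar> powr k)" "0 \<le> l" "0 \<le> y"
  shows "measure_pmf.expectation F (\<lambda>x. indicator {x. Z x \<le> y} x * exp (l * Z x))
    \<le> 1 + l * measure_pmf.expectation F Z
        + measure_pmf.expectation F (\<lambda>x. \<bar>Z x\<bar> powr k) * l powr k * exp (l * y)"
proof -
  have Z: "integrable (measure_pmf F) Z"
    by (rule integrable_of_integrable_powr[OF assms(1,3)])
  have "measure_pmf.expectation F (\<lambda>x. indicator {x. Z x \<le> y} x * exp (l * Z x))
    \<le> measure_pmf.expectation F (\<lambda>x. 1 + l * Z x + \<bar>Z x\<bar> powr k * (l powr k * exp (l * y)))"
  proof (intro integral_mono)
    have "exp (l * Z x) \<le> exp (l * y)" if "Z x \<le> y" for x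
      using that assms by (simp add: mult_left_mono)
    then show "integrable (measure_pmf F) (\<lambda>x. indicator {x. Z x \<le> y} x * exp (l * Z x))"
      by (intro integrable_pmf_bounded[of _ "exp (l * y)"]) (auto simp: indicator_def)
    show "integrable (measure_pmf F) (\<lambda>x. 1 + l * Z x + \<bar>Z x\<bar> powr k * (l powr k * exp (l * y)))"
      using assms(3) Z by simp
    fix x
    show "indicator {x. Z x \<le> y} x * exp (l * Z x) \<le> 1 + l * Z x + \<bar>Z x\<bar> powr k * (l powr k * exp (l * y))"
    proof (cases "Z x \<le> y")
      case True
      have "exp (l * Z x) - 1 - l * Z x \<le> \<bar>l * Z x\<bar> powr k * exp (max (l * Z x) 0)"
        by (rule exp_minus_one_minus_id_le[OF assms(1,2)])
      also have "\<dots> \<le> \<bar>l * Z x\<bar> powr k * exp (l * y)"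
        using True assms(4,5) by (intro mult_left_mono) (auto intro: mult_left_mono)
      also have "\<dots> = \<bar>Z x\<bar> powr k * (l powr k * exp (l * y))"
        using assms(4) by (simp add: powr_mult abs_mult)
      finally show ?thesis using True by simp
    next
      case False
      then have "0 \<le> l * Z x" using assms by simp
      then show ?thesis using False by (simp add: add_nonneg_nonneg)
    qed
  qed
  also have "\<dots> = 1 + l * measure_pmf.expectation F Z
        + measure_pmf.expectation F (\<lambda>x. \<bar>Z x\<bar> powr k) * l powr k * exp (l * y)"
    using assms(3) Z by simp
  finally show ?thesis .
qed

section \<open>Bounds that are uniform in the number of summands\<close>

context regvar_pmf begin

text \<open>The uniform component is taken on [x, 2 x) with x of order n powr (1 / g). Its weight is
  at least of order x powr (1 - \<alpha> - e), so n times the weight grows like n powr (e / g) at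
  least, and the chance of never using the component becomes negligible beside 1 / x.\<close>

lemma pmf_sum_concentration_powr:
  assumes "\<alpha> - 1 < g"
  obtains C where "0 < C" "\<And>n t. 1 \<le> n \<Longrightarrow> pmf (sum_pmf F n) t \<le> C * real n powr (- (1 / g))"
proof -
  define e where "e = (g - (\<alpha> - 1)) / 2"
  have e: "0 < e" and g: "\<alpha> - 1 + e < g" "0 < g" "g - (\<alpha> - 1 + e) = e"
    using assms \<alpha>_gt_1 by (auto simp: e_def field_simps)
  obtain c t0 where c: "0 < c" "1 \<le> t0"
    and low: "\<And>t::int. t0 \<le> t \<Longrightarrow> c * real_of_int t powr (-\<alpha> - e) \<le> pmf F t"
    using pmf_lower[OF e] by metis
  define K where "K = 2 + real_of_int t0"
  have K: "0 < K" using c by (simp add: K_def)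
  define d where "d = c * 2 powr (-\<alpha> - e) * K powr (1 - \<alpha> - e)"
  have d: "0 < d" using c K by (simp add: d_def)
  define C where "C = 1 + (1 / e) powr (1 / e) * d powr (- (1 / e))"
  show thesis
  proof (rule that)
    have "0 \<le> (1 / e) powr (1 / e) * d powr (- (1 / e))" by simp
    then show "0 < C" unfolding C_def by linarith
    fix n :: nat and t :: int
    assume n: "1 \<le> n"
    define v where "v = real n powr (1 / g)"
    have v1: "1 \<le> v" unfolding v_def using n g by (intro ge_one_powr_ge_zero) auto
    define x where "x = \<lceil>v\<rceil> + t0"
    have x: "v \<le> real_of_int x" "real_of_int x \<le> K * v" "t0 \<le> x" "0 < x"
    proof -
      show "v \<le> real_of_int x" "t0 \<le> x" "0 < x" using c v1 unfolding x_def by linarith+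
      have "real_of_int x \<le> v + 1 + real_of_int t0" unfolding x_def by linarith
      also have "\<dots> \<le> v + v + real_of_int t0 * v"
      proof -
        have "real_of_int t0 * 1 \<le> real_of_int t0 * v" using v1 c by (intro mult_left_mono) auto
        then show ?thesis using v1 by linarith
      qed
      finally show "real_of_int x \<le> K * v" by (simp add: K_def algebra_simps)
    qed
    define B where "B = {x..<2 * x}"
    define q where "q = c * (2 * real_of_int x) powr (-\<alpha> - e)"
    have B: "finite B" "B \<noteq> {}" "real (card B) = real_of_int x" using x by (auto simp: B_def)
    have q: "q \<le> pmf F k" if "k \<in> B" for k
    proof -
      have k: "x \<le> k" "k < 2 * x" using that by (auto simp: B_def)
      have "q \<le> c * real_of_int k powr (-\<alpha> - e)"
        unfolding q_def using c x k e \<alpha>_gt_1 by (intro mult_left_mono powr_mono2') auto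
      also have "\<dots> \<le> pmf F k" using k x by (intro low) auto
      finally show ?thesis .
    qed
    have q0: "0 \<le> q" using c by (simp add: q_def)
    have w1: "card B * q \<le> 1"
    proof -
      have "card B * q = (\<Sum>k\<in>B. q)" by simp
      also have "\<dots> \<le> (\<Sum>k\<in>B. pmf F k)" using q by (rule sum_mono)
      also have "\<dots> \<le> 1" by (simp flip: measure_measure_pmf_finite[OF B(1)])
      finally show ?thesis .
    qed
    have w: "d * v powr (1 - \<alpha> - e) \<le> card B * q"
    proof -
      have "d * v powr (1 - \<alpha> - e) = c * 2 powr (-\<alpha> - e) * (K * v) powr (1 - \<alpha> - e)"
        using K v1 by (simp add: d_def powr_mult)
      also have "\<dots> \<le> c * 2 powr (-\<alpha> - e) * real_of_int x powr (1 - \<alpha> - e)"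
        using x c e \<alpha>_gt_1 by (intro mult_left_mono powr_mono2') auto
      also have "\<dots> = card B * q"
      proof -
        have "real_of_int x powr (1 - \<alpha> - e) = real_of_int x powr 1 * real_of_int x powr (-\<alpha> - e)"
          by (subst powr_add[symmetric]) (simp add: algebra_simps)
        then show ?thesis using x by (simp add: B q_def powr_mult)
      qed
      finally show ?thesis .
    qed
    have vn: "v powr (1 - \<alpha> - e) * real n = real n powr (e / g)"
    proof -
      have "v powr (1 - \<alpha> - e) * real n = real n powr ((1 - \<alpha> - e) / g) * real n powr 1"
        using n by (simp add: v_def powr_powr)
      also have "\<dots> = real n powr ((1 - \<alpha> - e) / g + 1)" by (rule powr_add[symmetric])
      also have "(1 - \<alpha> - e) / g + 1 = e / g"
        using g by (simp add: field_simps)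
      finally show ?thesis .
    qed
    have "(1 - card B * q) ^ n \<le> exp (- (card B * q)) ^ n"
      using w1 exp_ge_add_one_self[of "- (card B * q)"] by (intro power_mono) auto
    also have "\<dots> = exp (- (real n * (card B * q)))" by (simp add: exp_of_nat_mult[symmetric])
    also have "\<dots> \<le> exp (- (d * real n powr (e / g)))"
      using mult_right_mono[OF w, of "real n"] by (simp add: vn[symmetric] mult_ac)
    \<comment> \<open>The order 1 / e turns n powr (e / g) into n powr (- (1 / g)), the size of the
      other term.\<close>
    also have "\<dots> \<le> (1 / e) powr (1 / e) * (d * real n powr (e / g)) powr (- (1 / e))"
      using d n e by (intro exp_neg_le_powr) auto
    also have "\<dots> = (1 / e) powr (1 / e) * d powr (- (1 / e)) * real n powr (- (1 / g))"
      using d n e by (simp add: powr_mult powr_powr)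
    finally have tail: "(1 - card B * q) ^ n \<le> \<dots>" .
    have "1 / real (card B) \<le> 1 / v" unfolding B(3) using x v1 by (intro divide_left_mono) auto
    also have "\<dots> = real n powr (- (1 / g))" by (simp add: v_def powr_minus_divide)
    finally have "1 / card B + (1 - card B * q) ^ n \<le> C * real n powr (- (1 / g))"
      using tail by (simp add: C_def algebra_simps)
    then show "pmf (sum_pmf F n) t \<le> C * real n powr (- (1 / g))"
      using pmf_sum_concentration[OF B(1,2) q q0, of n t] by linarith
  qed
qed

text \<open>The moment bound is a hypothesis because three regimes supply it: first-order moments of
  the positive part and a non-positive mean, both with mu = 0, and a positive mean with mu equal to
  it.\<close>

lemma pmf_sum_single_jump:
  assumes "0 < k'" "k' < k" "0 \<le> mu" "0 \<le> m"
    and exp_moment: "\<And>l y. 0 \<le> l \<Longrightarrow> 0 \<le> y \<Longrightarrow>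
      measure_pmf.expectation F (\<lambda>x. indicator {x. real_of_int x \<le> y} x * exp (l * real_of_int x))
        \<le> 1 + l * mu + m * l powr k * exp (l * y)"
  obtains C where "0 < C" "\<forall>\<^sub>F t::nat in sequentially. \<forall>n. real n \<le> real t powr k' \<longrightarrow>
      2 * real n * mu \<le> real t \<longrightarrow> 1 \<le> n \<longrightarrow> pmf (sum_pmf F n) (int t) \<le> C * real n * pmf F (int t)"
proof -
  \<comment> \<open>Half the gap between k' and k. With exp (l * y) = t powr s, the remainder n * l
    powr k * exp (l * y) is still at most of order t powr (- s) up to logarithms.\<close>
  define s where "s = (k - k') / 2"
  have s: "0 < s" "k' + s - k = - s" using assms by (auto simp: s_def field_simps)
  \<comment> \<open>The tilt gains exp (- l * t) = t powr (- b * s), of which the drift consumes at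
    most half because 2 n mu \<le> t. The choice of b leaves at most a multiple of t powr (-\<alpha>
    - 1), which is dominated by pmf F t.\<close>
  define b where "b = max 1 (2 * (\<alpha> + 1) / s)"
  have b: "1 \<le> b" "\<alpha> + 1 \<le> b * s / 2"
    using s by (auto simp: b_def max_def field_simps)
  obtain C1 t1 where C1: "1 \<le> C1" "1 \<le> t1"
    and dec: "\<And>s t::int. t1 \<le> t \<Longrightarrow> real_of_int t / b \<le> real_of_int s \<Longrightarrow> pmf F s \<le> C1 * pmf F t"
    by (rule pmf_almost_decreasing[OF b(1)]) blast
  obtain c t2 where c: "0 < c" "1 \<le> t2"
    and low: "\<And>t::int. t2 \<le> t \<Longrightarrow> c * real_of_int t powr (-\<alpha> - 1) \<le> pmf F t"
    using pmf_lower[of 1] by (metis zero_less_one)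
  have lim: "(\<lambda>t::nat. m * (b * s) powr k * ((ln (real t)) powr k * real t powr (- s))) \<longlonglongrightarrow> m * (b * s) powr k * 0"
    using s assms by (intro tendsto_mult tendsto_const) real_asymp
  have small: "\<forall>\<^sub>F t::nat in sequentially. m * (b * s) powr k * ((ln (real t)) powr k * real t powr (- s)) < 1"
    by (rule order_tendstoD(2)[OF lim]) simp
  define C where "C = exp 1 / c + C1"
  show thesis
  proof (rule that)
    show "0 < C" using c C1 by (simp add: C_def add_pos_pos)
    show "\<forall>\<^sub>F t::nat in sequentially. \<forall>n. real n \<le> real t powr k' \<longrightarrow>
      2 * real n * mu \<le> real t \<longrightarrow> 1 \<le> n \<longrightarrow> pmf (sum_pmf F n) (int t) \<le> C * real n * pmf F (int t)"
      using small eventually_ge_at_top[of "nat t1"] eventually_ge_at_top[of "nat t2"]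
    proof (eventually_elim, intro allI impI)
      fix t n :: nat
      assume sm: "m * (b * s) powr k * (ln (real t) powr k * real t powr (- s)) < 1"
        and "nat t1 \<le> t" "nat t2 \<le> t"
        and n: "real n \<le> real t powr k'" "2 * real n * mu \<le> real t" "1 \<le> n"
      then have t: "t1 \<le> int t" "t2 \<le> int t" by auto
      have t1: "1 \<le> real t" using t C1 by linarith
      define y where "y = real t / b"
      define l where "l = b * s * ln (real t) / real t"
      define A where "A = measure_pmf.expectation F (\<lambda>x. indicator {x. real_of_int x \<le> y} x * exp (l * real_of_int x))"
      have y: "0 \<le> y" using b by (simp add: y_def)
      have l: "0 \<le> l" using b s t1 by (simp add: l_def)
      have lt: "l * real t = b * s * ln (real t)" using t1 by (simp add: l_def)
      have ly: "exp (l * y) = real t powr s"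
        using t1 b by (simp add: l_def y_def powr_def)
      have A0: "0 \<le> A" unfolding A_def by (auto intro!: integral_nonneg_AE)
      have "pmf (sum_pmf F n) (int t) \<le> exp (- l * real_of_int (int t)) * A ^ n + (\<Sum>j<n. C1 * pmf F (int t))"
        unfolding A_def
      proof (rule pmf_sum_tilt)
        show "exp (l * real_of_int x) \<le> exp (l * y)" if "x \<in> {x. real_of_int x \<le> y}" for x
          using that l by (simp add: mult_left_mono)
        show "measure_pmf.expectation F (\<lambda>x. indicator (- {x. real_of_int x \<le> y}) x * pmf (sum_pmf F j) (r - x))
          \<le> C1 * pmf F (int t)" for j r
          by (rule expectation_tail_le) (use t C1 in \<open>auto simp: y_def intro!: dec\<close>)
      qed
      also have "exp (- l * real_of_int (int t)) * A ^ n \<le> exp 1 * real t powr (-\<alpha> - 1)"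
      proof -
        define h where "h = l * mu + m * l powr k * exp (l * y)"
        have "A \<le> 1 + h" unfolding A_def h_def using exp_moment[OF l y] by simp
        also have "\<dots> \<le> exp h" by (rule exp_ge_add_one_self)
        finally have "A ^ n \<le> exp h ^ n" using A0 by (intro power_mono)
        also have "\<dots> = exp (real n * h)" by (simp add: exp_of_nat_mult)
        finally have An: "A ^ n \<le> exp (real n * h)" .
        have "real n * (m * l powr k * exp (l * y)) \<le> real t powr k' * (m * l powr k * exp (l * y))"
          using n assms by (intro mult_right_mono) auto
        also have "\<dots> = m * (b * s) powr k * (ln (real t) powr k * (real t powr k' * real t powr s * real t powr (- k)))"
          unfolding ly unfolding l_def using b s t1 by (simp add: powr_mult powr_divide powr_minus_divide)
        also have "real t powr k' * real t powr s * real t powr (- k) = real t powr (- s)"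
        proof -
          have "k' + s + - k = - s" using s by simp
          then show ?thesis by (simp only: powr_add[symmetric])
        qed
        finally have h2: "real n * (m * l powr k * exp (l * y)) \<le> 1" using sm by linarith
        have "real n * (l * mu) = l * (2 * real n * mu) / 2" by simp
        also have "\<dots> \<le> l * real t / 2" using n l by (intro divide_right_mono mult_left_mono) auto
        finally have "real n * h \<le> l * real t / 2 + 1" using h2 by (simp add: h_def algebra_simps)
        then have "- l * real t + real n * h \<le> 1 - (b * s / 2) * ln (real t)"
          using lt by simp
        also have "\<dots> \<le> 1 - (\<alpha> + 1) * ln (real t)"
          using b t1 by (intro diff_left_mono mult_right_mono) auto
        finally have "exp (- l * real t + real n * h) \<le> exp (1 - (\<alpha> + 1) * ln (real t))" by simp
        also have "\<dots> = exp 1 * real t powr (-\<alpha> - 1)"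
          using t1 by (simp add: powr_def algebra_simps flip: exp_add)
        finally have "exp (- l * real t) * exp (real n * h) \<le> exp 1 * real t powr (-\<alpha> - 1)"
          by (simp only: exp_add)
        moreover have "exp (- l * real t) * A ^ n \<le> exp (- l * real t) * exp (real n * h)"
          using An by (intro mult_left_mono) auto
        ultimately have "exp (- l * real t) * A ^ n \<le> exp 1 * real t powr (-\<alpha> - 1)" by linarith
        then show ?thesis by simp
      qed
      also have "exp 1 * real t powr (-\<alpha> - 1) \<le> exp 1 / c * pmf F (int t)"
        using low[OF t(2)] c by (simp add: field_simps)
      also have "\<dots> = exp 1 / c * 1 * pmf F (int t)" by simp
      also have "\<dots> \<le> exp 1 / c * real n * pmf F (int t)"
        using n c by (intro mult_right_mono mult_left_mono) auto
      finally show "pmf (sum_pmf F n) (int t) \<le> C * real n * pmf F (int t)"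
        by (simp add: C_def algebra_simps)
    qed
  qed
qed

text \<open>After concentration the claim amounts to a bound of t powr \<alpha>, with some margin,
  by n powr (1 + \<tau> + 1 / g); the smallest n in the range is the worst case.\<close>

lemma pmf_sum_many_terms:
  assumes "0 < \<tau>"
  obtains d C where "0 < d" "d < \<alpha> - 1" "0 < C"
    "\<And>k'. \<alpha> - 1 - d \<le> k' \<Longrightarrow> \<forall>\<^sub>F t::nat in sequentially. \<forall>n. real t powr k' \<le> real n \<longrightarrow>
      pmf (sum_pmf F n) (int t) \<le> C * real n powr (1 + \<tau>) * pmf F (int t)"
proof -
  define a where "a = \<alpha> - 1"
  have a: "0 < a" using \<alpha>_gt_1 by (simp add: a_def)
  \<comment> \<open>At d = 0 the expression equals a * \<tau> > 0. By continuity a small d can be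
    spent three times: on the range of n, on the concentration exponent, and on slow variation in
    the lower bound for pmf F t.\<close>
  have "((\<lambda>d. (a - d) * (1 + \<tau> + 1 / (a + d)) - (a + 1 + d)) \<longlongrightarrow> (a - 0) * (1 + \<tau> + 1 / (a + 0)) - (a + 1 + 0)) (at_right 0)"
    by (intro tendsto_intros) (use a in auto)
  then have "\<forall>\<^sub>F d in at_right 0. 0 < (a - d) * (1 + \<tau> + 1 / (a + d)) - (a + 1 + d)"
    by (rule order_tendstoD) (use a assms in \<open>simp add: algebra_simps\<close>)
  moreover have "\<forall>\<^sub>F d in at_right 0. d < a" using a by (rule eventually_at_right_real[THEN eventually_mono]) auto
  moreover have "\<forall>\<^sub>F d::real in at_right 0. 0 < d" by (rule eventually_at_right_less)
  ultimately have "\<forall>\<^sub>F d in at_right 0. 0 < (a - d) * (1 + \<tau> + 1 / (a + d)) - (a + 1 + d) \<and> d < a \<and> 0 < d"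
    by eventually_elim auto
  then obtain d where d: "0 < (a - d) * (1 + \<tau> + 1 / (a + d)) - (a + 1 + d)" "d < a" "0 < d"
    using eventually_happens by force
  obtain C1 where C1: "0 < C1" "\<And>n t. 1 \<le> n \<Longrightarrow> pmf (sum_pmf F n) t \<le> C1 * real n powr (- (1 / (a + d)))"
    using pmf_sum_concentration_powr[of "a + d"] d by (auto simp: a_def)
  obtain c t0 where c: "0 < c" "1 \<le> t0"
    and low: "\<And>t::int. t0 \<le> t \<Longrightarrow> c * real_of_int t powr (-\<alpha> - d) \<le> pmf F t"
    using pmf_lower[OF d(3)] by metis
  show thesis
  proof (rule that)
    show "0 < d" "d < \<alpha> - 1" "0 < C1 / c" using d C1 c by (auto simp: a_def)
    fix k' assume k': "\<alpha> - 1 - d \<le> k'"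
    show "\<forall>\<^sub>F t::nat in sequentially. \<forall>n. real t powr k' \<le> real n \<longrightarrow>
      pmf (sum_pmf F n) (int t) \<le> C1 / c * real n powr (1 + \<tau>) * pmf F (int t)"
      using eventually_ge_at_top[of "nat t0"]
    proof (eventually_elim, intro allI impI)
      fix t n :: nat
      assume "nat t0 \<le> t" and n: "real t powr k' \<le> real n"
      then have t: "t0 \<le> int t" by simp
      have t1: "1 \<le> real t" using t c by linarith
      have "1 \<le> real t powr k'" using t1 k' d by (intro ge_one_powr_ge_zero) (auto simp: a_def)
      then have n1: "1 \<le> n" using n by linarith
      define r where "r = 1 + \<tau> + 1 / (a + d)"
      have r0: "0 < 1 / (a + d)" using d a by simp
      have r: "0 \<le> r" using r0 assms by (simp add: r_def)
      have "real t powr (\<alpha> + d) \<le> real t powr ((a - d) * r)"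
        using t1 d by (intro powr_mono) (auto simp: r_def a_def)
      also have "\<dots> \<le> real t powr (k' * r)"
        using t1 k' r by (intro powr_mono mult_right_mono) (auto simp: a_def)
      also have "\<dots> = (real t powr k') powr r" by (simp add: powr_powr)
      also have "\<dots> \<le> real n powr r" using n r by (intro powr_mono2) auto
      finally have key: "real t powr (\<alpha> + d) \<le> real n powr r" .
      have "pmf (sum_pmf F n) (int t) \<le> C1 * real n powr (- (1 / (a + d)))" using C1 n1 by simp
      also have "real n powr (- (1 / (a + d))) = real n powr (1 + \<tau>) * (1 / real n powr r)"
        using n1 by (simp add: r_def powr_add powr_minus field_simps)
      also have "C1 * (real n powr (1 + \<tau>) * (1 / real n powr r))
          \<le> C1 * (real n powr (1 + \<tau>) * (1 / real t powr (\<alpha> + d)))"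
        using key C1 n1 t1 by (intro mult_left_mono divide_left_mono) auto
      also have "1 / real t powr (\<alpha> + d) = real t powr (-\<alpha> - d)"
        by (simp flip: powr_minus_divide)
      also have "C1 * (real n powr (1 + \<tau>) * real t powr (-\<alpha> - d))
          \<le> C1 * (real n powr (1 + \<tau>) * (pmf F (int t) / c))"
        using low[OF t] c C1 by (intro mult_left_mono) (auto simp: field_simps)
      finally show "pmf (sum_pmf F n) (int t) \<le> C1 / c * real n powr (1 + \<tau>) * pmf F (int t)"
        by (simp add: field_simps)
    qed
  qed
qed

end

section \<open>Power sums, and moments from tail bounds\<close>

lemma powr_Suc_diff:
  fixes r :: real and j :: nat
  assumes "0 < r"
  obtains z where "real j < z" "z < real j + 1" "(real j + 1) powr r - real j powr r = r * z powr (r - 1)"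
proof -
  have "\<exists>l z. real j < z \<and> z < real j + 1 \<and> DERIV (\<lambda>x. x powr r) z :> l
      \<and> (real j + 1) powr r - real j powr r = (real j + 1 - real j) * l"
  proof (rule MVT)
    show "continuous_on {real j..real j + 1} (\<lambda>x. x powr r)"
      using assms by (intro continuous_on_powr' continuous_on_id continuous_on_const) auto
    fix x assume "real j < x"
    then have "0 < x" by linarith
    then have "DERIV (\<lambda>x. x powr r) x :> r * x powr (r - 1)" by (rule has_real_derivative_powr)
    then show "(\<lambda>x. x powr r) differentiable (at x)" unfolding real_differentiable_def by blast
  qed simp
  then obtain l z where z: "real j < z" "z < real j + 1" "DERIV (\<lambda>x. x powr r) z :> l"
      "(real j + 1) powr r - real j powr r = (real j + 1 - real j) * l"
    by blast
  have "0 < z" using z(1) by linarith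
  then have "DERIV (\<lambda>x. x powr r) z :> r * z powr (r - 1)"
    by (rule has_real_derivative_powr)
  then have "l = r * z powr (r - 1)" using z(3) DERIV_unique by blast
  with z(4) have "(real j + 1) powr r - real j powr r = r * z powr (r - 1)" by simp
  with z(1,2) that show thesis by blast
qed

text \<open>Comparison with the integral of x powr (- s), through the increments of its
  antiderivative.\<close>

lemma sum_powr_neg_le:
  fixes s :: real
  assumes "0 \<le> s" "s < 1"
  shows "(\<Sum>j<n. real (Suc j) powr (- s)) \<le> real n powr (1 - s) / (1 - s)"
proof (induction n)
  case (Suc n)
  obtain z where z: "real n < z" "z < real n + 1"
      "(real n + 1) powr (1 - s) - real n powr (1 - s) = (1 - s) * z powr (1 - s - 1)"
    using powr_Suc_diff[of "1 - s" n] assms by auto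
  have "real (Suc n) powr (- s) \<le> z powr (- s)"
    using z assms by (intro powr_mono2') auto
  also have "\<dots> = (real (Suc n) powr (1 - s) - real n powr (1 - s)) / (1 - s)"
    using z(3) assms by (simp add: field_simps)
  finally show ?case using Suc.IH by (simp add: diff_divide_distrib)
qed simp

text \<open>Summation by parts turns a tail bound into a moment bound.\<close>

lemma integrable_powr_of_tail:
  fixes Z :: "int \<Rightarrow> nat"
  assumes "1 \<le> k" "k < k2"
    and tail: "\<And>j. measure_pmf.prob F {x. j < Z x} \<le> C * real (Suc j) powr (- k2)"
  shows "integrable (measure_pmf F) (\<lambda>x. real (Z x) powr k)"
proof (rule integrableI_bounded)
  have telescope: "real n powr k = (\<Sum>j<n. (real (Suc j) powr k - real j powr k))" for n
    using sum_lessThan_telescope[of "\<lambda>j. real j powr k" n] assms by simp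
  \<comment> \<open>The derivative of x powr k at the right end of [j, j + 1]; it bounds the
    increment because k \<ge> 1.\<close>
  define c where "c j = k * real (Suc j) powr (k - 1)" for j
  have c: "real (Suc j) powr k - real j powr k \<le> c j" for j
  proof -
    obtain z where z: "real j < z" "z < real j + 1"
        "(real j + 1) powr k - real j powr k = k * z powr (k - 1)"
      using powr_Suc_diff[of k j] assms by auto
    have "z powr (k - 1) \<le> real (Suc j) powr (k - 1)" using z assms by (intro powr_mono2) auto
    then show ?thesis using z(3) assms by (simp add: c_def add.commute mult_left_mono)
  qed
  have le: "real n powr k \<le> (\<Sum>j<n. c j)" for n
    by (subst telescope, rule sum_mono, rule c)
  have c0: "0 \<le> c j" for j using assms by (simp add: c_def)
  have "(\<integral>\<^sup>+ x. ennreal (norm (real (Z x) powr k)) \<partial>measure_pmf F)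
      \<le> (\<integral>\<^sup>+ x. (\<Sum>j. ennreal (c j) * indicator {x. j < Z x} x) \<partial>measure_pmf F)"
  proof (rule nn_integral_mono)
    fix x
    have "ennreal (norm (real (Z x) powr k)) \<le> ennreal (\<Sum>j<Z x. c j)"
      using le[of "Z x"] by (intro ennreal_leI) simp
    also have "\<dots> = (\<Sum>j<Z x. ennreal (c j))"
      using c0 by (intro sum_ennreal[symmetric])
    also have "\<dots> = (\<Sum>j<Z x. ennreal (c j) * indicator {x. j < Z x} x)"
      by (intro sum.cong) auto
    also have "\<dots> \<le> (\<Sum>j. ennreal (c j) * indicator {x. j < Z x} x)"
      by (rule sum_le_suminf) auto
    finally show "ennreal (norm (real (Z x) powr k)) \<le> (\<Sum>j. ennreal (c j) * indicator {x. j < Z x} x)" .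
  qed
  also have "\<dots> = (\<Sum>j. \<integral>\<^sup>+ x. ennreal (c j) * indicator {x. j < Z x} x \<partial>measure_pmf F)"
    by (rule nn_integral_suminf) simp
  also have "\<dots> = (\<Sum>j. ennreal (c j * measure_pmf.prob F {x. j < Z x}))"
    using c0 by (simp add: nn_integral_cmult measure_pmf.emeasure_eq_measure ennreal_mult)
  also have "\<dots> < \<infinity>"
  proof -
    have "summable (\<lambda>j. c j * measure_pmf.prob F {x. j < Z x})"
    proof (rule summable_comparison_test')
      have "summable (\<lambda>j. real (Suc j) powr (k - 1 - k2))"
        using assms by (subst summable_Suc_iff) (simp add: summable_real_powr_iff)
      then show "summable (\<lambda>j. k * C * real (Suc j) powr (k - 1 - k2))" by (rule summable_mult)
      fix j
      have "c j * measure_pmf.prob F {x. j < Z x} \<le> c j * (C * real (Suc j) powr (- k2))"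
        by (intro mult_left_mono tail c0)
      also have "\<dots> = k * C * (real (Suc j) powr (k - 1) * real (Suc j) powr (- k2))"
        by (simp add: c_def)
      also have "real (Suc j) powr (k - 1) * real (Suc j) powr (- k2) = real (Suc j) powr (k - 1 - k2)"
        by (subst powr_add[symmetric]) simp
      finally show "norm (c j * measure_pmf.prob F {x. j < Z x}) \<le> k * C * real (Suc j) powr (k - 1 - k2)"
        using c0[of j] by simp
    qed
    then show ?thesis using c0 by (subst suminf_ennreal2) auto
  qed
  finally show "(\<integral>\<^sup>+ x. ennreal (norm (real (Z x) powr k)) \<partial>measure_pmf F) < \<infinity>" .
qed simp

lemma prob_powr_Markov:
  fixes Z :: "int \<Rightarrow> real"
  assumes "integrable (measure_pmf F) (\<lambda>x. \<bar>Z x\<bar> powr k)" "0 \<le> k" "0 < y"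
  shows "measure_pmf.prob F {x. y \<le> Z x} \<le> measure_pmf.expectation F (\<lambda>x. \<bar>Z x\<bar> powr k) * y powr (- k)"
proof -
  have "measure_pmf.prob F {x. y \<le> Z x} * y powr k
      = measure_pmf.expectation F (\<lambda>x. indicator {x. y \<le> Z x} x * y powr k)" by simp
  also have "\<dots> \<le> measure_pmf.expectation F (\<lambda>x. \<bar>Z x\<bar> powr k)"
  proof (intro integral_mono assms(1))
    show "integrable (measure_pmf F) (\<lambda>x. indicator {x. y \<le> Z x} x * y powr k)"
      by (rule integrable_pmf_bounded[of _ "y powr k"]) (auto simp: indicator_def)
    show "indicator {x. y \<le> Z x} x * y powr k \<le> \<bar>Z x\<bar> powr k" for x
      using assms by (auto simp: indicator_def intro!: powr_mono2)
  qed
  finally show ?thesis using assms(3) by (simp add: powr_minus field_simps)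
qed

lemma integrable_pmf_nat_summable:
  fixes h :: "int \<Rightarrow> real"
  assumes "summable (\<lambda>j. pmf F (int j) * h (int j))" "\<And>x. 0 \<le> h x" "\<And>x. x < 0 \<Longrightarrow> h x = 0"
  shows "integrable (measure_pmf F) h"
proof (rule integrableI_bounded)
  have "(\<integral>\<^sup>+ x. ennreal (norm (h x)) \<partial>measure_pmf F)
      = (\<integral>\<^sup>+ x. ennreal (pmf F x * h x) \<partial>count_space UNIV)"
    using assms(2) by (simp add: nn_integral_measure_pmf ennreal_mult)
  also have "\<dots> = (\<integral>\<^sup>+ x. ennreal (pmf F x * h x) \<partial>count_space (range int))"
  proof (rule nn_integral_count_space_eq)
    fix x assume "x \<in> UNIV - range int"
    then have "x < 0" by (metis DiffD2 int_nat_eq linorder_not_less rangeI)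
    then show "ennreal (pmf F x * h x) = 0" by (simp add: assms(3))
  qed auto
  also have "\<dots> = (\<integral>\<^sup>+ j. ennreal (pmf F (int j) * h (int j)) \<partial>count_space UNIV)"
    by (rule nn_integral_bij_count_space[symmetric]) (simp add: bij_betw_def inj_on_def)
  also have "\<dots> = (\<Sum>j. ennreal (pmf F (int j) * h (int j)))"
    by (rule nn_integral_count_space_nat)
  also have "\<dots> < \<infinity>" using assms(1,2) by (subst suminf_ennreal2) auto
  finally show "(\<integral>\<^sup>+ x. ennreal (norm (h x)) \<partial>measure_pmf F) < \<infinity>" .
qed simp

section \<open>Moments of the step and transience\<close>

context regvar_pmf begin

lemma integrable_pos_part_powr:
  assumes "0 < k" "k < \<alpha> - 1"
  shows "integrable (measure_pmf F) (\<lambda>x. max (real_of_int x) 0 powr k)"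
proof (rule integrable_pmf_nat_summable)
  define e where "e = (\<alpha> - 1 - k) / 2"
  have e: "0 < e" "k - \<alpha> + e < - 1" using assms by (auto simp: e_def field_simps)
  obtain C where C: "0 < C" "\<And>t::int. 1 \<le> t \<Longrightarrow> pmf F t \<le> C * real_of_int t powr (-\<alpha> + e)"
    using pmf_upper[OF e(1)] by metis
  show "summable (\<lambda>j. pmf F (int j) * max (real_of_int (int j)) 0 powr k)"
  proof (rule summable_comparison_test'[where N = 1])
    show "summable (\<lambda>j. C * real j powr (k - \<alpha> + e))"
      using e by (intro summable_mult) (simp add: summable_real_powr_iff)
    fix j :: nat assume j: "1 \<le> j"
    have "pmf F (int j) * real j powr k \<le> C * real j powr (-\<alpha> + e) * real j powr k"
      using C(2)[of "int j"] j by (intro mult_right_mono) auto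
    also have "\<dots> = C * (real j powr (-\<alpha> + e) * real j powr k)" by simp
    also have "real j powr (-\<alpha> + e) * real j powr k = real j powr (k - \<alpha> + e)"
      by (subst powr_add[symmetric]) (simp add: algebra_simps)
    finally show "norm (pmf F (int j) * max (real_of_int (int j)) 0 powr k) \<le> C * real j powr (k - \<alpha> + e)"
      by simp
  qed
qed (auto simp: max_def)

text \<open>The left tail is compared with the right one, which Markov's inequality at an order k2
  strictly between k and \<alpha> - 1 makes small enough to be summed. The constant real (Suc r)
  powr k2 takes care of the j below r, where no comparison is available.\<close>

lemma integrable_abs_powr:
  assumes "1 \<le> k" "k < \<alpha> - 1" "0 \<le> C"
    and tail: "\<And>j::nat. r \<le> j \<Longrightarrow> measure_pmf.prob F {x. x < - int j} \<le> C * measure_pmf.prob F {x. int j < x}"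
  shows "integrable (measure_pmf F) (\<lambda>x. \<bar>real_of_int x\<bar> powr k)"
proof -
  obtain k2 where k2: "k < k2" "k2 < \<alpha> - 1" using assms(2) dense by blast
  define m where "m = measure_pmf.expectation F (\<lambda>x. \<bar>max (real_of_int x) 0\<bar> powr k2)"
  have m: "0 \<le> m" unfolding m_def by (auto intro!: integral_nonneg_AE)
  have int2: "integrable (measure_pmf F) (\<lambda>x. \<bar>max (real_of_int x) 0\<bar> powr k2)"
    using integrable_pos_part_powr[of k2] k2 assms by simp
  have neg: "integrable (measure_pmf F) (\<lambda>x. real (nat (- x)) powr k)"
  proof (rule integrable_powr_of_tail[OF assms(1) k2(1)])
    fix j :: nat
    have eq: "{x. j < nat (- x)} = {x. x < - int j}" by auto
    show "measure_pmf.prob F {x. j < nat (- x)} \<le> (C * m + real (Suc r) powr k2) * real (Suc j) powr (- k2)"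
    proof (cases "r \<le> j")
      case True
      have "{x. int j < x} = {x. real (Suc j) \<le> max (real_of_int x) 0}" by (auto simp: max_def)
      then have "measure_pmf.prob F {x. int j < x} \<le> m * real (Suc j) powr (- k2)"
        using prob_powr_Markov[OF int2, of "real (Suc j)"] k2 assms by (simp add: m_def)
      then have "C * measure_pmf.prob F {x. int j < x} \<le> C * (m * real (Suc j) powr (- k2))"
        using assms(3) by (rule mult_left_mono)
      also have "\<dots> \<le> (C * m + real (Suc r) powr k2) * real (Suc j) powr (- k2)"
        by (simp add: distrib_right mult_ac)
      finally show ?thesis using tail[OF True] unfolding eq by linarith
    next
      case False
      have "measure_pmf.prob F {x. j < nat (- x)} \<le> 1" by simp
      also have "1 = real (Suc j) powr k2 * real (Suc j) powr (- k2)" by (simp flip: powr_add)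
      also have "\<dots> \<le> (C * m + real (Suc r) powr k2) * real (Suc j) powr (- k2)"
      proof (intro mult_right_mono)
        have "real (Suc j) powr k2 \<le> real (Suc r) powr k2"
          using False k2 assms by (intro powr_mono2) auto
        then show "real (Suc j) powr k2 \<le> C * m + real (Suc r) powr k2"
          using assms(3) m by (simp add: add_increasing)
      qed simp
      finally show ?thesis .
    qed
  qed
  have "\<bar>real_of_int x\<bar> powr k = max (real_of_int x) 0 powr k + real (nat (- x)) powr k" for x
    using assms(1) by (cases "0 \<le> x") (auto simp: max_def)
  then show ?thesis
    using Bochner_Integration.integrable_add[OF integrable_pos_part_powr[of k] neg] assms by simp
qed

text \<open>Transience: a walk with positive drift returns to \<open>0\<close> at time \<open>n\<close> either against the drift
  with no big negative step, which is exponentially unlikely, or after one big negative step, which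
  costs its tail probability times the concentration bound.\<close>

lemma summable_return_probability:
  assumes "2 < \<alpha>" "\<alpha> \<le> 3"
    and moments: "\<And>k. 1 \<le> k \<Longrightarrow> k < \<alpha> - 1 \<Longrightarrow> integrable (measure_pmf F) (\<lambda>x. \<bar>real_of_int x\<bar> powr k)"
    and mean: "0 < measure_pmf.expectation F real_of_int"
  shows "summable (\<lambda>n. pmf (sum_pmf F n) 0)"
proof -
  define a where "a = \<alpha> - 1"
  have a: "1 < a" "a \<le> 2" using assms by (auto simp: a_def)
  \<comment> \<open>This is a + 1 / a - 2, the limit for d to 0 of the surplus
    \<open>\<rho> - 1\<close> of the decay exponent below. It is positive since a > 1, and is
    written in the shape of the limit that follows.\<close>
  have "0 < a * (1 - 0) + 1 / (a + 0) - 2"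
  proof -
    have "0 < (a - 1)\<^sup>2 / a" using a by simp
    also have "\<dots> = a * (1 - 0) + 1 / (a + 0) - 2" using a by (simp add: power2_eq_square field_simps)
    finally show ?thesis .
  qed
  moreover have "((\<lambda>d. (a - d) * (1 - d) + 1 / (a + d) - 2) \<longlongrightarrow> (a - 0) * (1 - 0) + 1 / (a + 0) - 2) (at_right 0)"
    by (intro tendsto_intros) (use a in auto)
  ultimately have "\<forall>\<^sub>F d in at_right 0. 0 < (a - d) * (1 - d) + 1 / (a + d) - 2"
    by (intro order_tendstoD(1)) auto
  moreover have "\<forall>\<^sub>F d in at_right 0. d < min (a - 1) 1"
    using a by (intro eventually_at_right_real[of 0, THEN eventually_mono]) auto
  moreover have "\<forall>\<^sub>F d::real in at_right 0. 0 < d" by (rule eventually_at_right_less)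
  ultimately have "\<forall>\<^sub>F d in at_right 0. 0 < (a - d) * (1 - d) + 1 / (a + d) - 2 \<and> d < min (a - 1) 1 \<and> 0 < d"
    by eventually_elim auto
  then obtain d where d: "0 < (a - d) * (1 - d) + 1 / (a + d) - 2" "d < a - 1" "d < 1" "0 < d"
    using eventually_happens by force
  define k where "k = a - d"
  define g where "g = a + d"
  have k: "1 < k" "k \<le> 2" and g: "1 < g" using a d by (auto simp: k_def g_def)
  have int: "integrable (measure_pmf F) (\<lambda>x. \<bar>- real_of_int x\<bar> powr k)"
    using moments[of k] k d by (simp add: k_def a_def)
  define m where "m = measure_pmf.expectation F (\<lambda>x. \<bar>- real_of_int x\<bar> powr k)"
  have m: "0 \<le> m" unfolding m_def by (auto intro!: integral_nonneg_AE)
  define \<mu> where "\<mu> = measure_pmf.expectation F real_of_int"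
  have \<mu>: "0 < \<mu>" using mean by (simp add: \<mu>_def)
  obtain C1 where C1: "0 < C1" "\<And>n t. 1 \<le> n \<Longrightarrow> pmf (sum_pmf F n) t \<le> C1 * real n powr (- (1 / g))"
    using pmf_sum_concentration_powr[of g] d by (auto simp: a_def g_def)
  \<comment> \<open>Rewriting the bound with \<open>Suc j\<close> includes j = 0: the summand 1
    covers that case, and j \<ge> Suc j / 2 accounts for the other summand.\<close>
  define C3 where "C3 = 1 + C1 * 2 powr (1 / g)"
  have C3: "0 < C3" unfolding C3_def using C1 by (intro add_pos_nonneg) auto
  have conc: "pmf (sum_pmf F j) t \<le> C3 * real (Suc j) powr (- (1 / g))" for j t
  proof (cases "j = 0")
    case True
    have "0 \<le> C1 * 2 powr (1 / g)" using C1 by simp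
    moreover have "pmf (sum_pmf F j) t \<le> 1" by (rule pmf_le_1)
    ultimately have "pmf (sum_pmf F j) t \<le> C3" unfolding C3_def by linarith
    then show ?thesis using True by simp
  next
    case False
    have "pmf (sum_pmf F j) t \<le> C1 * real j powr (- (1 / g))" using C1 False by simp
    also have "\<dots> \<le> C1 * (real (Suc j) / 2) powr (- (1 / g))"
      using C1 False g by (intro mult_left_mono powr_mono2') auto
    also have "\<dots> = (C1 * 2 powr (1 / g)) * real (Suc j) powr (- (1 / g))"
      by (simp add: powr_divide powr_minus field_simps)
    also have "\<dots> \<le> C3 * real (Suc j) powr (- (1 / g))"
      by (intro mult_right_mono) (auto simp: C3_def)
    finally show ?thesis .
  qed
  define K where "K = (2 / d) powr (2 / d) * (\<mu> / 2) powr (- (2 / d))"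
  define C4 where "C4 = m * C3 / (1 - 1 / g)"
  \<comment> \<open>A step below - n powr (1 - d) has probability at most of order n powr (- k * (1
    - d)), and the concentration bounds up to n sum to n powr (1 - 1 / g); \<open>- \<rho>\<close>
    is the total exponent.\<close>
  define \<rho> where "\<rho> = k * (1 - d) + 1 / g - 1"
  have \<rho>: "1 < \<rho>" using d by (simp add: \<rho>_def k_def g_def)
  have lim: "(\<lambda>n::nat. m * exp 1 * (real n powr (1 - d)) powr (1 - k)) \<longlonglongrightarrow> m * exp 1 * 0"
  proof (intro tendsto_mult tendsto_const tendsto_neg_powr)
    show "filterlim (\<lambda>n::nat. real n powr (1 - d)) at_top sequentially"
      using d by real_asymp
  qed (use k in simp)
  have small: "\<forall>\<^sub>F n::nat in sequentially. m * exp 1 * (real n powr (1 - d)) powr (1 - k) < \<mu> / 2"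
    by (rule order_tendstoD(2)[OF lim]) (use \<mu> in simp)
  have "\<forall>\<^sub>F n::nat in sequentially.
      norm (pmf (sum_pmf F n) 0) \<le> K * real n powr (- 2) + C4 * real n powr (- \<rho>)"
    using small eventually_ge_at_top[of 1]
  proof eventually_elim
    case (elim n)
    \<comment> \<open>Slightly sublinear truncation: with tilt - 1 / y each step gains a factor at
      most 1 - \<mu> / (2 y), so that n steps without a big negative one cost exp (- \<mu> / 2 * n
      powr d).\<close>
    define y where "y = real n powr (1 - d)"
    have y: "0 < y" using elim by (simp add: y_def)
    define J where "J = {x. - real_of_int x \<le> y}"
    define A where "A = measure_pmf.expectation F (\<lambda>x. indicator J x * exp (- (1 / y) * real_of_int x))"
    have A0: "0 \<le> A" unfolding A_def by (auto intro!: integral_nonneg_AE)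
    have "A \<le> 1 + 1 / y * measure_pmf.expectation F (\<lambda>x. - real_of_int x) + m * (1 / y) powr k * exp (1 / y * y)"
      using truncated_exp_moment_high[OF _ k(2) int, of "1 / y" y] k y
      by (simp add: A_def J_def m_def)
    also have "\<dots> = 1 - \<mu> / y + (m * exp 1 * y powr (1 - k)) / y"
      using y by (simp add: \<mu>_def powr_divide powr_diff)
    also have "\<dots> \<le> 1 - \<mu> / y + (\<mu> / 2) / y"
      using elim y by (intro add_left_mono divide_right_mono) (auto simp: y_def)
    also have "\<dots> = 1 + - (\<mu> / 2 / y)" using y by (simp add: field_simps)
    also have "\<dots> \<le> exp (- (\<mu> / 2 / y))" by (rule exp_ge_add_one_self)
    finally have "A ^ n \<le> exp (- (\<mu> / 2 / y)) ^ n" using A0 by (intro power_mono)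
    also have "\<dots> = exp (- (\<mu> / 2 * (real n / y)))" by (simp flip: exp_of_nat_mult)
    also have "real n / y = real n powr d"
    proof -
      have "real n / y = real n powr 1 / real n powr (1 - d)" by (simp add: y_def)
      also have "\<dots> = real n powr d" by (subst powr_diff[symmetric]) simp
      finally show ?thesis .
    qed
    also have "exp (- (\<mu> / 2 * real n powr d)) \<le> (2 / d) powr (2 / d) * (\<mu> / 2 * real n powr d) powr (- (2 / d))"
      using \<mu> elim d by (intro exp_neg_le_powr) auto
    also have "\<dots> = K * real n powr (- 2)"
      using d \<mu> by (subst powr_mult) (simp_all add: K_def powr_powr)
    finally have An: "A ^ n \<le> K * real n powr (- 2)" .
    have "pmf (sum_pmf F n) 0 \<le> exp (- (- (1 / y)) * real_of_int 0) * A ^ n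
        + (\<Sum>j<n. measure_pmf.prob F (- J) * (C3 * real (Suc j) powr (- (1 / g))))"
      unfolding A_def
    proof (rule pmf_sum_tilt)
      show "exp (- (1 / y) * real_of_int x) \<le> exp 1" if "x \<in> J" for x
        using that y by (simp add: J_def field_simps)
    qed (intro expectation_tail_le' conc)
    then have "pmf (sum_pmf F n) 0 \<le> A ^ n
        + measure_pmf.prob F (- J) * (C3 * (\<Sum>j<n. real (Suc j) powr (- (1 / g))))"
      by (simp add: sum_distrib_left)
    also have "measure_pmf.prob F (- J) * (C3 * (\<Sum>j<n. real (Suc j) powr (- (1 / g))))
        \<le> (m * y powr (- k)) * (C3 * (real n powr (1 - 1 / g) / (1 - 1 / g)))"
    proof (intro mult_mono order_refl)
      have "measure_pmf.prob F (- J) \<le> measure_pmf.prob F {x. y \<le> - real_of_int x}"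
        by (rule measure_pmf.finite_measure_mono) (auto simp: J_def)
      also have "\<dots> \<le> m * y powr (- k)"
        unfolding m_def by (rule prob_powr_Markov[OF int]) (use k y in auto)
      finally show "measure_pmf.prob F (- J) \<le> m * y powr (- k)" .
      show "(\<Sum>j<n. real (Suc j) powr (- (1 / g))) \<le> real n powr (1 - 1 / g) / (1 - 1 / g)"
        by (rule sum_powr_neg_le) (use g in auto)
    qed (use C3 m in \<open>auto intro!: mult_nonneg_nonneg sum_nonneg\<close>)
    also have "\<dots> = C4 * (y powr (- k) * real n powr (1 - 1 / g))"
      by (simp add: C4_def)
    also have "y powr (- k) * real n powr (1 - 1 / g) = real n powr (- \<rho>)"
    proof -
      have "y powr (- k) * real n powr (1 - 1 / g) = real n powr ((1 - d) * (- k)) * real n powr (1 - 1 / g)"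
        by (simp only: y_def powr_powr)
      also have "\<dots> = real n powr ((1 - d) * (- k) + (1 - 1 / g))" by (rule powr_add[symmetric])
      also have "(1 - d) * (- k) + (1 - 1 / g) = - \<rho>" by (simp add: \<rho>_def algebra_simps)
      finally show ?thesis .
    qed
    finally show ?case using An by simp
  qed
  moreover have "summable (\<lambda>n::nat. K * real n powr (- 2) + C4 * real n powr (- \<rho>))"
    using \<rho> by (intro summable_add summable_mult) (simp_all add: summable_real_powr_iff)
  ultimately show ?thesis by (rule summable_comparison_test_ev)
qed

end

lemma pmf_nat_expectation_le:
  fixes f :: "nat \<Rightarrow> real"
  assumes "\<And>n. 0 \<le> f n" "integrable (measure_pmf P) f" "\<And>m. (\<Sum>n\<le>m. pmf P n * f n) \<le> B"
  shows "measure_pmf.expectation P f \<le> B"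
proof -
  have "integrable (count_space UNIV) (\<lambda>n. pmf P n * f n)"
    using assms(2) unfolding measure_pmf_eq_density by (subst (asm) integrable_density) auto
  from sums_integral_count_space_nat[OF this]
  have s: "(\<lambda>n. pmf P n * f n) sums measure_pmf.expectation P f"
    by (simp add: integral_pmf_count_space)
  have "(\<lambda>m. \<Sum>n\<le>m. pmf P n * f n) \<longlonglongrightarrow> measure_pmf.expectation P f"
    using s unfolding sums_def_le by simp
  then show ?thesis by (rule LIMSEQ_le_const2) (use assms(3) in auto)
qed

section \<open>Summation over the random number of terms\<close>

context regvar_pmf begin

text \<open>\<open>K t\<close> consists of the n for which domination by n powr (1 + \<tau>) is
  available. Since every fixed n belongs to it eventually, the cut leaves the limit unchanged, and
  the complement is left to a separate estimate.\<close>

lemma random_sum_asymp_truncated: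
  fixes P :: "nat pmf" and K :: "nat \<Rightarrow> nat set"
  assumes "integrable (measure_pmf P) (\<lambda>n. real n powr (1 + \<tau>))" and "0 \<le> C"
    and K: "\<And>n. \<forall>\<^sub>F t in sequentially. n \<in> K t"
    and bound: "\<forall>\<^sub>F t::nat in sequentially. \<forall>n\<in>K t. pmf (sum_pmf F n) (int t) \<le> C * real n powr (1 + \<tau>) * pmf F (int t)"
    and rest: "(\<lambda>t::nat. measure_pmf.expectation P (\<lambda>n. indicator (- K t) n * pmf (sum_pmf F n) (int t)) / pmf F (int t)) \<longlonglongrightarrow> 0"
  shows "(\<lambda>t::nat. measure_pmf.expectation P (\<lambda>n. pmf (sum_pmf F n) (int t)) / pmf F (int t))
    \<longlonglongrightarrow> measure_pmf.expectation P real"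
proof -
  obtain t0 :: int where t0: "1 \<le> t0" "\<And>t. t0 \<le> t \<Longrightarrow> 0 < pmf F t"
    by (rule pmf_eventually_pos) blast
  have pos: "\<forall>\<^sub>F t::nat in sequentially. 0 < pmf F (int t)"
    using eventually_ge_at_top[of "nat t0"] by eventually_elim (use t0 in auto)
  define s where "s = (\<lambda>(t::nat) n. indicator (K t) n * pmf (sum_pmf F n) (int t) / pmf F (int t))"
  have lim: "(\<lambda>t. measure_pmf.expectation P (s t)) \<longlonglongrightarrow> measure_pmf.expectation P real"
  proof (rule pmf_dominated_convergence)
    show "integrable (measure_pmf P) (\<lambda>n. C * real n powr (1 + \<tau>))" using assms(1) by simp
    fix n
    have "\<forall>\<^sub>F t in sequentially. pmf (sum_pmf F n) (int t) / pmf F (int t) = s t n"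
      using K[of n] by eventually_elim (simp add: s_def)
    with pmf_sum_asymp[of n] show "(\<lambda>t. s t n) \<longlonglongrightarrow> real n" by (rule Lim_transform_eventually)
  next
    show "\<forall>\<^sub>F t in sequentially. \<forall>n. \<bar>s t n\<bar> \<le> C * real n powr (1 + \<tau>)"
      using bound pos eventually_ge_at_top[of 1]
    proof eventually_elim
      case (elim t)
      have "\<bar>s t n\<bar> \<le> C * real n powr (1 + \<tau>)" for n
      proof (cases "n \<in> K t")
        case True
        then show ?thesis using elim by (simp add: s_def divide_le_eq)
      qed (use assms(2) in \<open>simp add: s_def\<close>)
      then show ?case by blast
    qed
  qed
  have int: "integrable (measure_pmf P) (\<lambda>n. indicator J n * pmf (sum_pmf F n) (int t))" for J t
    by (rule measure_pmf.integrable_const_bound[of _ 1]) (auto simp: indicator_def pmf_le_1)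
  have "measure_pmf.expectation P (\<lambda>n. pmf (sum_pmf F n) (int t)) / pmf F (int t)
     = measure_pmf.expectation P (s t)
      + measure_pmf.expectation P (\<lambda>n. indicator (- K t) n * pmf (sum_pmf F n) (int t)) / pmf F (int t)" for t
  proof -
    have "measure_pmf.expectation P (\<lambda>n. pmf (sum_pmf F n) (int t))
      = measure_pmf.expectation P (\<lambda>n. indicator (K t) n * pmf (sum_pmf F n) (int t)
          + indicator (- K t) n * pmf (sum_pmf F n) (int t))"
      by (intro Bochner_Integration.integral_cong) (auto simp: indicator_def)
    also have "\<dots> = measure_pmf.expectation P (\<lambda>n. indicator (K t) n * pmf (sum_pmf F n) (int t))
          + measure_pmf.expectation P (\<lambda>n. indicator (- K t) n * pmf (sum_pmf F n) (int t))"
      by (rule Bochner_Integration.integral_add[OF int int])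
    finally show ?thesis by (simp add: s_def add_divide_distrib)
  qed
  then show ?thesis using tendsto_add[OF lim rest] by simp
qed

theorem random_sum_asymp:
  fixes P :: "nat pmf"
  assumes "\<alpha> \<le> 3" "0 < \<tau>"
    and P: "integrable (measure_pmf P) (\<lambda>n. real n powr (1 + \<tau>))"
    and tail: "2 < \<alpha> \<Longrightarrow> \<exists>C\<ge>0. \<exists>r. \<forall>j\<ge>r.
        measure_pmf.prob F {x. x < - int j} \<le> C * measure_pmf.prob F {x. int j < x}"
    and P_tail: "2 < \<alpha> \<Longrightarrow> 0 < measure_pmf.expectation F real_of_int \<Longrightarrow>
        \<exists>\<beta>>0. \<exists>C\<ge>0. \<exists>r. \<forall>n\<ge>r. pmf P n \<le> C * real n powr (- \<alpha> - \<beta>)"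
  shows "(\<lambda>t::nat. measure_pmf.expectation P (\<lambda>n. pmf (sum_pmf F n) (int t)) / pmf F (int t))
    \<longlonglongrightarrow> measure_pmf.expectation P real"
proof -
  have moments: "integrable (measure_pmf F) (\<lambda>x. \<bar>real_of_int x\<bar> powr k)"
    if "2 < \<alpha>" "1 \<le> k" "k < \<alpha> - 1" for k
    using tail[OF that(1)] integrable_abs_powr[OF that(2,3)] by blast
  show ?thesis
  proof (cases "2 < \<alpha> \<and> 0 < measure_pmf.expectation F real_of_int")
    case False
    obtain d C2 where d: "0 < d" "d < \<alpha> - 1" "0 < C2"
      and many: "\<And>k'. \<alpha> - 1 - d \<le> k' \<Longrightarrow> \<forall>\<^sub>F t::nat in sequentially. \<forall>n. real t powr k' \<le> real n \<longrightarrow>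
        pmf (sum_pmf F n) (int t) \<le> C2 * real n powr (1 + \<tau>) * pmf F (int t)"
      using pmf_sum_many_terms[OF \<open>0 < \<tau>\<close>] by blast
    \<comment> \<open>The exponent at which the single-jump bound hands over to concentration. The
      moment order k chosen below lies strictly between k' and \<alpha> - 1.\<close>
    define k' where "k' = \<alpha> - 1 - d"
    have "\<exists>k m. k' < k \<and> 0 \<le> m \<and> (\<forall>l\<ge>0. \<forall>y\<ge>0.
        measure_pmf.expectation F (\<lambda>x. indicator {x. real_of_int x \<le> y} x * exp (l * real_of_int x))
          \<le> 1 + l * 0 + m * l powr k * exp (l * y))"
    proof (cases "2 < \<alpha>")
      case False
      define k where "k = \<alpha> - 1 - d / 2"
      have k: "0 < k" "k \<le> 1" "k < \<alpha> - 1" "k' < k" using False d by (auto simp: k_def k'_def)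
      then show ?thesis
        using truncated_exp_moment_low[OF k(1,2) integrable_pos_part_powr[OF k(1,3)]]
        by (intro exI[of _ k] exI[of _ "measure_pmf.expectation F (\<lambda>x. max (real_of_int x) 0 powr k)"])
           (auto intro!: integral_nonneg_AE)
    next
      case True
      define k where "k = max 1 (\<alpha> - 1 - d / 2)"
      have k: "1 \<le> k" "k \<le> 2" "k < \<alpha> - 1" "k' < k"
        using True d \<open>\<alpha> \<le> 3\<close> by (auto simp: k_def k'_def)
      \<comment> \<open>A non-positive mean only lowers the exponential moment, so the drift term is
        replaced by 0.\<close>
      have neg: "measure_pmf.expectation F real_of_int \<le> 0" using False True by simp
      define m where "m = measure_pmf.expectation F (\<lambda>x. \<bar>real_of_int x\<bar> powr k)"
      have "measure_pmf.expectation F (\<lambda>x. indicator {x. real_of_int x \<le> y} x * exp (l * real_of_int x))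
          \<le> 1 + l * 0 + m * l powr k * exp (l * y)" if "0 \<le> l" "0 \<le> y" for l y
        using truncated_exp_moment_high[OF k(1,2) moments[OF True k(1,3)] that]
          mult_nonneg_nonpos[OF that(1) neg] by (simp add: m_def)
      moreover have "0 \<le> m" unfolding m_def by (auto intro!: integral_nonneg_AE)
      ultimately show ?thesis using k by blast
    qed
    then obtain k m where k: "k' < k" "0 \<le> m" and exp_moment: "\<And>l y. 0 \<le> l \<Longrightarrow> 0 \<le> y \<Longrightarrow>
        measure_pmf.expectation F (\<lambda>x. indicator {x. real_of_int x \<le> y} x * exp (l * real_of_int x))
          \<le> 1 + l * 0 + m * l powr k * exp (l * y)"
      by blast
    have "0 < k'" using d by (simp add: k'_def)
    from pmf_sum_single_jump[OF this k(1) order_refl k(2) exp_moment]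
    obtain C1 where C1: "0 < C1" and few: "\<forall>\<^sub>F t::nat in sequentially. \<forall>n. real n \<le> real t powr k' \<longrightarrow>
        2 * real n * 0 \<le> real t \<longrightarrow> 1 \<le> n \<longrightarrow> pmf (sum_pmf F n) (int t) \<le> C1 * real n * pmf F (int t)"
      by blast
    define C where "C = max C1 C2"
    show ?thesis
    proof (rule random_sum_asymp_truncated[where K = "\<lambda>_. UNIV" and C = C, OF P])
      show "0 \<le> C" using C1 by (simp add: C_def)
      have "\<forall>\<^sub>F t::nat in sequentially. \<forall>n. real t powr k' \<le> real n \<longrightarrow>
          pmf (sum_pmf F n) (int t) \<le> C2 * real n powr (1 + \<tau>) * pmf F (int t)"
        by (rule many) (simp add: k'_def)
      then show "\<forall>\<^sub>F t::nat in sequentially. \<forall>n\<in>UNIV.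
          pmf (sum_pmf F n) (int t) \<le> C * real n powr (1 + \<tau>) * pmf F (int t)"
        using few eventually_ge_at_top[of 1]
      proof eventually_elim
        case (elim t)
        have "pmf (sum_pmf F n) (int t) \<le> C * real n powr (1 + \<tau>) * pmf F (int t)" for n
        proof -
          consider "n = 0" | "1 \<le> n" "real n \<le> real t powr k'" | "real t powr k' \<le> real n" by linarith
          then show ?thesis
          proof cases
            case 1
            then show ?thesis using elim(3) by (simp add: indicator_def)
          next
            case 2
            then have "pmf (sum_pmf F n) (int t) \<le> C1 * real n * pmf F (int t)" using elim(2) by simp
            also have "\<dots> \<le> C * real n powr (1 + \<tau>) * pmf F (int t)"
              using 2 C1 \<open>0 < \<tau>\<close> powr_mono[of 1 "1 + \<tau>" "real n"]
              by (intro mult_right_mono mult_mono) (auto simp: C_def)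
            finally show ?thesis .
          next
            case 3
            then have "pmf (sum_pmf F n) (int t) \<le> C2 * real n powr (1 + \<tau>) * pmf F (int t)" using elim(1) by simp
            also have "\<dots> \<le> C * real n powr (1 + \<tau>) * pmf F (int t)"
              by (intro mult_right_mono) (auto simp: C_def)
            finally show ?thesis .
          qed
        qed
        then show ?case by blast
      qed
    qed auto
  next
    case True
    define \<mu> where "\<mu> = measure_pmf.expectation F real_of_int"
    have \<alpha>: "2 < \<alpha>" and \<mu>: "0 < \<mu>" using True by (auto simp: \<mu>_def)
    \<comment> \<open>k' and k lie one and two thirds of the way from 1 to \<alpha> - 1. As k' > 1,
      all n \<le> t / (2 \<mu>) eventually satisfy n \<le> t powr k', so the single-jump bound
      covers all n \<ge> 1 in \<open>K t\<close>.\<close>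
    define k where "k = 1 + 2 * (\<alpha> - 2) / 3"
    define k' where "k' = 1 + (\<alpha> - 2) / 3"
    have k: "1 \<le> k" "k \<le> 2" "k < \<alpha> - 1" "k' < k" "1 < k'"
      using \<alpha> \<open>\<alpha> \<le> 3\<close> by (auto simp: k_def k'_def field_simps)
    define m where "m = measure_pmf.expectation F (\<lambda>x. \<bar>real_of_int x\<bar> powr k)"
    have m: "0 \<le> m" unfolding m_def by (auto intro!: integral_nonneg_AE)
    have exp_moment: "measure_pmf.expectation F (\<lambda>x. indicator {x. real_of_int x \<le> y} x * exp (l * real_of_int x))
        \<le> 1 + l * \<mu> + m * l powr k * exp (l * y)" if "0 \<le> l" "0 \<le> y" for l y
      using truncated_exp_moment_high[OF k(1,2) moments[OF \<alpha> k(1,3)] that] by (simp add: m_def \<mu>_def)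
    have "0 < k'" using k by simp
    from pmf_sum_single_jump[OF this k(4) less_imp_le[OF \<mu>] m exp_moment]
    obtain C where C: "0 < C" and few: "\<forall>\<^sub>F t::nat in sequentially. \<forall>n. real n \<le> real t powr k' \<longrightarrow>
        2 * real n * \<mu> \<le> real t \<longrightarrow> 1 \<le> n \<longrightarrow> pmf (sum_pmf F n) (int t) \<le> C * real n * pmf F (int t)"
      by blast
    define K where "K = (\<lambda>t::nat. {n::nat. 2 * real n * \<mu> \<le> real t})"
    have "summable (\<lambda>n. pmf (sum_pmf F n) 0)"
      using moments[OF \<alpha>] True \<open>\<alpha> \<le> 3\<close> by (intro summable_return_probability) auto
    define S where "S = (\<Sum>n. pmf (sum_pmf F n) 0)"
    have Green: "(\<Sum>n\<le>j. pmf (sum_pmf F n) t) \<le> S" for j t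
      using pmf_sum_Green_le[of F t j] sum_le_suminf[OF \<open>summable _\<close>, of "{..j}"]
      by (auto simp: S_def)
    obtain \<beta> D r where \<beta>: "0 < \<beta>" "0 \<le> D" and D: "\<And>n. r \<le> n \<Longrightarrow> pmf P n \<le> D * real n powr (- \<alpha> - \<beta>)"
      using P_tail[OF \<alpha>] \<mu> unfolding \<mu>_def by blast
    \<comment> \<open>Half of \<beta> absorbs the slow variation of pmf F t; the other half makes
      the remainder tend to 0.\<close>
    obtain c t0 where c: "0 < c" "1 \<le> t0"
      and low: "\<And>t::int. t0 \<le> t \<Longrightarrow> c * real_of_int t powr (-\<alpha> - \<beta> / 2) \<le> pmf F t"
      using pmf_lower[of "\<beta> / 2"] \<beta> by (metis half_gt_zero)
    define D' where "D' = D * (1 / (2 * \<mu>)) powr (- \<alpha> - \<beta>) * S"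
    show ?thesis
    proof (rule random_sum_asymp_truncated[where K = K and C = C, OF P])
      show "0 \<le> C" using C by simp
      show "\<forall>\<^sub>F t in sequentially. n \<in> K t" for n
        unfolding K_def mem_Collect_eq by real_asymp
      have "\<forall>\<^sub>F t::nat in sequentially. real t / (2 * \<mu>) \<le> real t powr k'"
        using k \<mu> by real_asymp
      then show "\<forall>\<^sub>F t in sequentially. \<forall>n\<in>K t.
          pmf (sum_pmf F n) (int t) \<le> C * real n powr (1 + \<tau>) * pmf F (int t)"
        using few eventually_ge_at_top[of 1]
      proof eventually_elim
        case (elim t)
        have "pmf (sum_pmf F n) (int t) \<le> C * real n powr (1 + \<tau>) * pmf F (int t)" if n: "n \<in> K t" for n
        proof (cases "n = 0")
          case True
          then show ?thesis using elim(3) by (simp add: indicator_def)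
        next
          case False
          have n': "2 * real n * \<mu> \<le> real t" using n by (simp add: K_def)
          then have "real n \<le> real t / (2 * \<mu>)" using \<mu> by (simp add: field_simps)
          then have "pmf (sum_pmf F n) (int t) \<le> C * real n * pmf F (int t)"
            using elim(1,2) n' False by auto
          also have "\<dots> \<le> C * real n powr (1 + \<tau>) * pmf F (int t)"
            using False C \<open>0 < \<tau>\<close> powr_mono[of 1 "1 + \<tau>" "real n"]
            by (intro mult_right_mono mult_left_mono) auto
          finally show ?thesis .
        qed
        then show ?case by blast
      qed
      have "(\<lambda>t::nat. D' / c * real t powr (- (\<beta> / 2))) \<longlonglongrightarrow> D' / c * 0"
        using \<beta> by (intro tendsto_mult tendsto_const) real_asymp
      then have lim: "(\<lambda>t::nat. D' / c * real t powr (- (\<beta> / 2))) \<longlonglongrightarrow> 0" by simp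
      show "(\<lambda>t::nat. measure_pmf.expectation P (\<lambda>n. indicator (- K t) n * pmf (sum_pmf F n) (int t)) / pmf F (int t)) \<longlonglongrightarrow> 0"
      proof (rule tendsto_sandwich[OF _ _ tendsto_const lim])
        show "\<forall>\<^sub>F t::nat in sequentially. 0 \<le> measure_pmf.expectation P (\<lambda>n. indicator (- K t) n * pmf (sum_pmf F n) (int t)) / pmf F (int t)"
          by (intro always_eventually allI divide_nonneg_nonneg integral_nonneg_AE) auto
        have "\<forall>\<^sub>F t::nat in sequentially. 2 * real r * \<mu> \<le> real t" by real_asymp
        then show "\<forall>\<^sub>F t::nat in sequentially. measure_pmf.expectation P (\<lambda>n. indicator (- K t) n * pmf (sum_pmf F n) (int t)) / pmf F (int t)
            \<le> D' / c * real t powr (- (\<beta> / 2))"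
          using eventually_ge_at_top[of "nat t0"]
        proof eventually_elim
          case (elim t)
          have t: "t0 \<le> int t" "1 \<le> real t" using elim c by linarith+
          define h where "h = D * (real t / (2 * \<mu>)) powr (- \<alpha> - \<beta>)"
          have h: "0 \<le> h" using \<beta> by (simp add: h_def)
          have "measure_pmf.expectation P (\<lambda>n. indicator (- K t) n * pmf (sum_pmf F n) (int t)) \<le> h * S"
          proof (rule pmf_nat_expectation_le)
            show "integrable (measure_pmf P) (\<lambda>n. indicator (- K t) n * pmf (sum_pmf F n) (int t))"
              by (rule measure_pmf.integrable_const_bound[of _ 1]) (auto simp: indicator_def pmf_le_1)
            fix j
            have term_le: "pmf P n * (indicator (- K t) n * pmf (sum_pmf F n) (int t)) \<le> h * pmf (sum_pmf F n) (int t)" for n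
            proof (cases "n \<in> K t")
              case False
              then have n: "real t \<le> 2 * real n * \<mu>" by (simp add: K_def)
              then have "2 * real r * \<mu> \<le> 2 * real n * \<mu>" using elim(1) by linarith
              then have "r \<le> n" using \<mu> by simp
              then have "pmf P n \<le> D * real n powr (- \<alpha> - \<beta>)" by (rule D)
              also have "\<dots> \<le> h"
                unfolding h_def using n \<mu> t \<beta> \<alpha>
                by (intro mult_left_mono powr_mono2') (auto simp: field_simps)
              finally show ?thesis using False by (simp add: mult_right_mono)
            qed (use h in simp)
            have "(\<Sum>n\<le>j. pmf P n * (indicator (- K t) n * pmf (sum_pmf F n) (int t)))
                \<le> h * (\<Sum>n\<le>j. pmf (sum_pmf F n) (int t))"
              unfolding sum_distrib_left by (rule sum_mono) (rule term_le)
            also have "\<dots> \<le> h * S" using h by (intro mult_left_mono Green)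
            finally show "(\<Sum>n\<le>j. pmf P n * (indicator (- K t) n * pmf (sum_pmf F n) (int t))) \<le> h * S" .
          qed simp
          also have "h * S = D' * real t powr (- \<alpha> - \<beta>)"
            using \<mu> by (simp add: h_def D'_def powr_divide)
          finally have up: "measure_pmf.expectation P (\<lambda>n. indicator (- K t) n * pmf (sum_pmf F n) (int t))
              \<le> D' * real t powr (- \<alpha> - \<beta>)" .
          have S0: "0 \<le> S" using Green[of 0 0] order_trans[OF pmf_nonneg] by fastforce
          have D'0: "0 \<le> D'" using \<beta> S0 by (simp add: D'_def)
          have "measure_pmf.expectation P (\<lambda>n. indicator (- K t) n * pmf (sum_pmf F n) (int t)) / pmf F (int t)
              \<le> D' * real t powr (- \<alpha> - \<beta>) / (c * real t powr (- \<alpha> - \<beta> / 2))"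
            using up low[OF t(1)] c t D'0 by (intro frac_le) auto
          also have "\<dots> = D' / c * (real t powr (- \<alpha> - \<beta>) / real t powr (- \<alpha> - \<beta> / 2))" by simp
          also have "real t powr (- \<alpha> - \<beta>) / real t powr (- \<alpha> - \<beta> / 2) = real t powr (- (\<beta> / 2))"
            by (subst powr_diff[symmetric]) (simp add: field_simps)
          finally show ?case .
        qed
      qed
    qed
  qed
qed

end

section \<open>From random variables to their laws\<close>

lemma real_sum_int_eq_iff: "(\<Sum>i\<in>A. real_of_int (f i)) = real_of_int t \<longleftrightarrow> sum f A = t"
  by (metis of_int_eq_iff of_int_sum)

lemma measurable_sum_int [measurable]:
  fixes X :: "nat \<Rightarrow> 'a \<Rightarrow> int"
  assumes [measurable]: "\<And>i. X i \<in> measurable M (count_space UNIV)"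
  shows "(\<lambda>\<omega>. \<Sum>i<n. X i \<omega>) \<in> measurable M (count_space UNIV)"
proof (subst measurable_count_space_eq2_countable, safe)
  fix t :: int
  have "(\<lambda>\<omega>. \<Sum>i<n. real_of_int (X i \<omega>)) \<in> borel_measurable M" by measurable
  then have "(\<lambda>\<omega>. \<Sum>i<n. real_of_int (X i \<omega>)) -` {real_of_int t} \<inter> space M \<in> sets M"
    by (rule measurable_sets) simp
  then show "(\<lambda>\<omega>. \<Sum>i<n. X i \<omega>) -` {t} \<inter> space M \<in> sets M"
    by (simp add: vimage_def real_sum_int_eq_iff)
qed auto

context prob_space begin

lemma obtain_pmf:
  fixes f :: "'a \<Rightarrow> 'b :: countable"
  assumes "f \<in> measurable M (count_space UNIV)"
  obtains P :: "'b pmf" where "measure_pmf P = distr M (count_space UNIV) f"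
    "\<And>A. measure_pmf.prob P A = prob {\<omega> \<in> space M. f \<omega> \<in> A}"
    "\<And>x. pmf P x = prob {\<omega> \<in> space M. f \<omega> = x}"
proof -
  let ?D = "distr M (count_space UNIV) f"
  interpret D: prob_space ?D by (rule prob_space_distr[OF assms])
  define P where "P = embed_pmf (\<lambda>x. measure ?D {x})"
  have "(\<integral>\<^sup>+ x. ennreal (measure ?D {x}) \<partial>count_space UNIV) = (\<integral>\<^sup>+ x. emeasure ?D {x} \<partial>count_space UNIV)"
    by (simp add: D.emeasure_eq_measure)
  also have "\<dots> = emeasure ?D UNIV"
    by (subst emeasure_countable_singleton) auto
  also have "\<dots> = 1" using D.emeasure_space_1 by simp
  finally have "(\<integral>\<^sup>+ x. ennreal (measure ?D {x}) \<partial>count_space UNIV) = 1" .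
  then have pmf_P: "pmf P x = measure ?D {x}" for x
    unfolding P_def by (subst pmf_embed_pmf) auto
  have eq: "measure_pmf P = ?D"
  proof (rule measure_eqI_countable[where A = UNIV])
    show "emeasure (measure_pmf P) {x} = emeasure ?D {x}" for x
      by (simp add: emeasure_pmf_single pmf_P D.emeasure_eq_measure)
  qed auto
  have prob_P: "measure_pmf.prob P A = prob {\<omega> \<in> space M. f \<omega> \<in> A}" for A
    unfolding eq by (subst measure_distr[OF assms]) (auto intro!: arg_cong[where f = prob])
  have "pmf P x = prob {\<omega> \<in> space M. f \<omega> = x}" for x
    using prob_P[of "{x}"] by (simp add: measure_pmf_single)
  with eq prob_P show thesis by (rule that)
qed

text \<open>The event is split by the value of \<open>X n\<close>. Its independence from the
  preceding sum is obtained for the real-valued copies and read off on singletons.\<close>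

lemma prob_sum_iid:
  fixes X :: "nat \<Rightarrow> 'a \<Rightarrow> int"
  assumes indep: "indep_vars (\<lambda>_. count_space UNIV) X UNIV"
    and F: "\<And>i k. prob {\<omega> \<in> space M. X i \<omega> = k} = pmf F k"
  shows "prob {\<omega> \<in> space M. (\<Sum>i<n. X i \<omega>) = t} = pmf (sum_pmf F n) t"
proof (induction n arbitrary: t)
  case 0
  then show ?case by (auto simp: indicator_def prob_space)
next
  case (Suc n)
  have meas [measurable]: "X i \<in> measurable M (count_space UNIV)" for i
    using indep by (auto simp: indep_vars_def)
  have "indep_vars (\<lambda>_. borel) (\<lambda>i \<omega>. real_of_int (X i \<omega>)) (insert n {..<n})"
    by (rule indep_vars_compose2[OF indep_vars_subset[OF indep subset_UNIV]]) auto
  then have ind: "indep_var borel (\<lambda>\<omega>. real_of_int (X n \<omega>)) borel (\<lambda>\<omega>. \<Sum>i<n. real_of_int (X i \<omega>))"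
    by (intro indep_vars_sum) auto
  define E where "E k = {\<omega> \<in> space M. X n \<omega> = k \<and> (\<Sum>i<n. X i \<omega>) = t - k}" for k
  have sum_meas [measurable]: "(\<lambda>\<omega>. \<Sum>i<n. X i \<omega>) \<in> measurable M (count_space UNIV)"
    by (rule measurable_sum_int) (rule meas)
  have E_sets: "E k \<in> events" for k
    unfolding E_def by measurable
  have prob_E: "prob (E k) = pmf F k * pmf (sum_pmf F n) (t - k)" for k
  proof -
    have "prob ((\<lambda>\<omega>. (real_of_int (X n \<omega>), \<Sum>i<n. real_of_int (X i \<omega>))) -` ({real_of_int k} \<times> {real_of_int (t - k)}) \<inter> space M)
        = prob ((\<lambda>\<omega>. real_of_int (X n \<omega>)) -` {real_of_int k} \<inter> space M)
          * prob ((\<lambda>\<omega>. \<Sum>i<n. real_of_int (X i \<omega>)) -` {real_of_int (t - k)} \<inter> space M)"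
      by (rule indep_varD[OF ind]) auto
    also have "(\<lambda>\<omega>. (real_of_int (X n \<omega>), \<Sum>i<n. real_of_int (X i \<omega>))) -` ({real_of_int k} \<times> {real_of_int (t - k)}) \<inter> space M = E k"
      unfolding E_def by (auto simp: real_sum_int_eq_iff simp del: of_int_diff)
    also have "(\<lambda>\<omega>. real_of_int (X n \<omega>)) -` {real_of_int k} \<inter> space M = {\<omega> \<in> space M. X n \<omega> = k}"
      by auto
    also have "(\<lambda>\<omega>. \<Sum>i<n. real_of_int (X i \<omega>)) -` {real_of_int (t - k)} \<inter> space M
        = {\<omega> \<in> space M. (\<Sum>i<n. X i \<omega>) = t - k}"
      by (auto simp: real_sum_int_eq_iff simp del: of_int_diff)
    finally show ?thesis by (simp add: F Suc.IH)
  qed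
  have "ennreal (prob {\<omega> \<in> space M. (\<Sum>i<Suc n. X i \<omega>) = t}) = emeasure M (\<Union>k. E k)"
    unfolding emeasure_eq_measure by (intro arg_cong[where f = "\<lambda>A. ennreal (prob A)"]) (auto simp: E_def)
  also have "\<dots> = (\<integral>\<^sup>+ k. emeasure M (E k) \<partial>count_space UNIV)"
    by (rule emeasure_UN_countable) (use E_sets in \<open>auto simp: disjoint_family_on_def E_def\<close>)
  also have "\<dots> = (\<integral>\<^sup>+ k. ennreal (pmf (sum_pmf F n) (t - k)) \<partial>measure_pmf F)"
    by (simp add: nn_integral_measure_pmf emeasure_eq_measure prob_E ennreal_mult)
  also have "\<dots> = ennreal (pmf (sum_pmf F (Suc n)) t)"
    by (simp add: ennreal_pmf_bind pmf_map_plus)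
  finally show ?case by simp
qed

text \<open>On N = n the event depends on the sequence only through a measurable set of the product
  space, so independence from the whole sequence factorises it.\<close>

lemma prob_random_sum_iid:
  fixes X :: "nat \<Rightarrow> 'a \<Rightarrow> int" and N :: "'a \<Rightarrow> nat"
  assumes indep: "indep_vars (\<lambda>_. count_space UNIV) X UNIV"
    and F: "\<And>i k. prob {\<omega> \<in> space M. X i \<omega> = k} = pmf F k"
    and N [measurable]: "N \<in> measurable M (count_space UNIV)"
    and P: "\<And>n. prob {\<omega> \<in> space M. N \<omega> = n} = pmf P n"
    and indep_N: "indep_of_sequence M N X"
  shows "prob {\<omega> \<in> space M. (\<Sum>i<N \<omega>. X i \<omega>) = t} = measure_pmf.expectation P (\<lambda>n. pmf (sum_pmf F n) t)"
proof -
  define E where "E n = {\<omega> \<in> space M. N \<omega> = n \<and> (\<Sum>i<n. X i \<omega>) = t}" for n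
  have meas [measurable]: "X i \<in> measurable M (count_space UNIV)" for i
    using indep by (auto simp: indep_vars_def)
  have sum_meas [measurable]: "(\<lambda>\<omega>. \<Sum>i<n. X i \<omega>) \<in> measurable M (count_space UNIV)" for n
    by (rule measurable_sum_int) (rule meas)
  have E_sets: "E n \<in> events" for n
    unfolding E_def by measurable
  have prob_E: "prob (E n) = pmf P n * pmf (sum_pmf F n) t" for n
  proof -
    let ?Q = "(\<Pi>\<^sub>M i\<in>UNIV. count_space UNIV) :: (nat \<Rightarrow> int) measure"
    have "prob ((N -` {n} \<inter> space M) \<inter> ((\<lambda>\<omega> i. X i \<omega>) -` {f. (\<Sum>i<n. f i) = t} \<inter> space M))
        = prob (N -` {n} \<inter> space M) * prob ((\<lambda>\<omega> i. X i \<omega>) -` {f. (\<Sum>i<n. f i) = t} \<inter> space M)"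
    proof (rule indep_setD[OF indep_N[unfolded indep_of_sequence_def]])
      show "N -` {n} \<inter> space M \<in> sets (vimage_algebra (space M) N (count_space UNIV))"
        by (rule in_vimage_algebra) simp
      have "(\<lambda>f. \<Sum>i<n. real_of_int (f i)) \<in> borel_measurable ?Q"
        by measurable
      then have "(\<lambda>f. \<Sum>i<n. real_of_int (f i)) -` {real_of_int t} \<inter> space ?Q \<in> sets ?Q"
        by (rule measurable_sets) simp
      also have "(\<lambda>f. \<Sum>i<n. real_of_int (f i)) -` {real_of_int t} \<inter> space ?Q = {f. (\<Sum>i<n. f i) = t}"
        by (auto simp: space_PiM real_sum_int_eq_iff)
      finally show "(\<lambda>\<omega> i. X i \<omega>) -` {f. (\<Sum>i<n. f i) = t} \<inter> space M \<in> sets (vimage_algebra (space M) (\<lambda>\<omega> i. X i \<omega>) ?Q)"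
        by (rule in_vimage_algebra)
    qed
    also have "(N -` {n} \<inter> space M) \<inter> ((\<lambda>\<omega> i. X i \<omega>) -` {f. (\<Sum>i<n. f i) = t} \<inter> space M) = E n"
      by (auto simp: E_def)
    also have "N -` {n} \<inter> space M = {\<omega> \<in> space M. N \<omega> = n}" by auto
    also have "(\<lambda>\<omega> i. X i \<omega>) -` {f. (\<Sum>i<n. f i) = t} \<inter> space M = {\<omega> \<in> space M. (\<Sum>i<n. X i \<omega>) = t}" by auto
    finally show ?thesis by (simp add: P prob_sum_iid[OF indep F])
  qed
  have "ennreal (prob {\<omega> \<in> space M. (\<Sum>i<N \<omega>. X i \<omega>) = t}) = emeasure M (\<Union>n. E n)"
    unfolding emeasure_eq_measure by (intro arg_cong[where f = "\<lambda>A. ennreal (prob A)"]) (auto simp: E_def)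
  also have "\<dots> = (\<integral>\<^sup>+ n. emeasure M (E n) \<partial>count_space UNIV)"
    by (rule emeasure_UN_countable) (use E_sets in \<open>auto simp: disjoint_family_on_def E_def\<close>)
  also have "\<dots> = (\<integral>\<^sup>+ n. ennreal (pmf (sum_pmf F n) t) \<partial>measure_pmf P)"
    by (simp add: nn_integral_measure_pmf emeasure_eq_measure prob_E ennreal_mult)
  also have "\<dots> = ennreal (pmf (bind_pmf P (sum_pmf F)) t)"
    by (simp add: ennreal_pmf_bind)
  finally show ?thesis by (simp add: pmf_bind)
qed

end

theorem theorem3:
  fixes M :: "'a measure"
    and X :: "nat \<Rightarrow> 'a \<Rightarrow> int"
    and N :: "'a \<Rightarrow> nat"
    and L\<^sub>1 :: "real \<Rightarrow> real"
    and \<alpha> \<tau> :: real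
  assumes "prob_space M"
    and "prob_space.indep_vars M (\<lambda>_. count_space UNIV) X UNIV"
    and "\<And>i. distr M (count_space UNIV) (X i) = distr M (count_space UNIV) (X 0)"
    and "N \<in> measurable M (count_space UNIV)"
    and "indep_of_sequence M N X"
    and "1 < \<alpha>" and "\<alpha> \<le> 3"
    and "slowly_varying L\<^sub>1"
    and "\<And>t::nat. t \<ge> 1 \<Longrightarrow>
           \<P>(\<omega> in M. X 0 \<omega> = int t) = real t powr (-\<alpha>) * L\<^sub>1 (real t)"
    and "\<tau> > 0"
    and "integrable M (\<lambda>\<omega>. real (N \<omega>) powr (1 + \<tau>))"
    and "2 < \<alpha> \<Longrightarrow>
           (\<lambda>t::real. \<P>(\<omega> in M. real_of_int (X 0 \<omega>) < - t))
             \<in> O[at_top](\<lambda>t. \<P>(\<omega> in M. real_of_int (X 0 \<omega>) > t))"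
    and "2 < \<alpha> \<Longrightarrow> (\<integral>\<omega>. real_of_int (X 0 \<omega>) \<partial>M) > 0 \<Longrightarrow>
           (\<exists>\<beta>>0. (\<lambda>t::nat. \<P>(\<omega> in M. N \<omega> = t))
                    \<in> O[at_top](\<lambda>t. real t powr (-\<alpha> - \<beta>)))"
  shows "(\<lambda>t::nat. \<P>(\<omega> in M. (\<Sum>i<N \<omega>. X i \<omega>) = int t))
           \<sim>[at_top] (\<lambda>t. (\<integral>\<omega>. real (N \<omega>) \<partial>M) * \<P>(\<omega> in M. X 0 \<omega> = int t))"
proof -
  interpret prob_space M by fact
  have meas [measurable]: "X i \<in> measurable M (count_space UNIV)" for i
    using assms(2) by (auto simp: indep_vars_def)
  obtain F where F: "measure_pmf F = distr M (count_space UNIV) (X 0)"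
      "\<And>A. measure_pmf.prob F A = prob {\<omega> \<in> space M. X 0 \<omega> \<in> A}"
      "\<And>k. pmf F k = prob {\<omega> \<in> space M. X 0 \<omega> = k}"
    by (rule obtain_pmf[OF meas]) blast
  obtain P where P: "measure_pmf P = distr M (count_space UNIV) N"
      "\<And>A. measure_pmf.prob P A = prob {\<omega> \<in> space M. N \<omega> \<in> A}"
      "\<And>n. pmf P n = prob {\<omega> \<in> space M. N \<omega> = n}"
    by (rule obtain_pmf[OF assms(4)]) blast
  have law: "prob {\<omega> \<in> space M. X i \<omega> = k} = pmf F k" for i k
  proof -
    have "prob {\<omega> \<in> space M. X i \<omega> = k} = measure (distr M (count_space UNIV) (X i)) {k}"
      by (subst measure_distr) (auto intro!: arg_cong[where f = prob])
    also have "\<dots> = pmf F k" unfolding assms(3)[of i] F(1)[symmetric] by (rule measure_pmf_single)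
    finally show ?thesis .
  qed
  have sum_eq: "\<P>(\<omega> in M. (\<Sum>i<N \<omega>. X i \<omega>) = t) = measure_pmf.expectation P (\<lambda>n. pmf (sum_pmf F n) t)" for t
    by (rule prob_random_sum_iid[OF assms(2) law assms(4) P(3)[symmetric] assms(5)])
  interpret regvar_pmf F L\<^sub>1 \<alpha>
  proof
    fix t :: int assume "1 \<le> t"
    then show "pmf F t = real_of_int t powr (-\<alpha>) * L\<^sub>1 (real_of_int t)"
      using assms(9)[of "nat t"] by (simp add: F(3))
  qed (use assms in auto)
  have EF: "measure_pmf.expectation F real_of_int = (\<integral>\<omega>. real_of_int (X 0 \<omega>) \<partial>M)"
    unfolding F(1) by (rule integral_distr) auto
  have EP: "measure_pmf.expectation P real = (\<integral>\<omega>. real (N \<omega>) \<partial>M)"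
    unfolding P(1) by (rule integral_distr) (use assms(4) in auto)
  have P_moment: "integrable (measure_pmf P) (\<lambda>n. real n powr (1 + \<tau>))"
    unfolding P(1) by (subst integrable_distr_eq) (use assms(4,11) in auto)
  have tail: "\<exists>C\<ge>0. \<exists>r. \<forall>j\<ge>r. measure_pmf.prob F {x. x < - int j} \<le> C * measure_pmf.prob F {x. int j < x}"
    if \<alpha>: "2 < \<alpha>"
  proof -
    obtain C where C: "0 < C" "\<forall>\<^sub>F t in at_top. norm \<P>(\<omega> in M. real_of_int (X 0 \<omega>) < - t)
        \<le> C * norm \<P>(\<omega> in M. real_of_int (X 0 \<omega>) > t)"
      using assms(12)[OF \<alpha>] by (rule landau_o.bigE)
    from C(2) obtain t1 where t1: "\<And>t. t1 \<le> t \<Longrightarrow> \<P>(\<omega> in M. real_of_int (X 0 \<omega>) < - t)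
        \<le> C * \<P>(\<omega> in M. real_of_int (X 0 \<omega>) > t)"
      unfolding eventually_at_top_linorder by auto
    have "measure_pmf.prob F {x. x < - int j} \<le> C * measure_pmf.prob F {x. int j < x}" if "nat \<lceil>t1\<rceil> \<le> j" for j
    proof -
      have 1: "(real_of_int x < - real j) = (x < - int j)" "(real j < real_of_int x) = (int j < x)" for x
        by linarith+
      have "t1 \<le> real j" using that by linarith
      from t1[OF this] show ?thesis by (simp add: F(2) 1)
    qed
    then have "\<forall>j\<ge>nat \<lceil>t1\<rceil>. measure_pmf.prob F {x. x < - int j} \<le> C * measure_pmf.prob F {x. int j < x}"
      by blast
    with less_imp_le[OF C(1)] show ?thesis by blast
  qed
  have P_tail: "\<exists>\<beta>>0. \<exists>C\<ge>0. \<exists>r. \<forall>n\<ge>r. pmf P n \<le> C * real n powr (- \<alpha> - \<beta>)"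
    if pos: "2 < \<alpha>" "0 < measure_pmf.expectation F real_of_int"
  proof -
    obtain \<beta> where \<beta>: "0 < \<beta>" "(\<lambda>t::nat. \<P>(\<omega> in M. N \<omega> = t)) \<in> O[at_top](\<lambda>t. real t powr (-\<alpha> - \<beta>))"
      using assms(13) pos unfolding EF by blast
    from \<beta>(2) obtain C where C: "0 < C"
        "\<forall>\<^sub>F t::nat in at_top. norm \<P>(\<omega> in M. N \<omega> = t) \<le> C * norm (real t powr (-\<alpha> - \<beta>))"
      by (rule landau_o.bigE)
    from C(2) obtain r where "\<forall>n\<ge>r. pmf P n \<le> C * real n powr (- \<alpha> - \<beta>)"
      unfolding eventually_at_top_linorder by (auto simp: P(3))
    with \<beta>(1) less_imp_le[OF C(1)] show ?thesis by blast
  qed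
  have lim: "(\<lambda>t::nat. measure_pmf.expectation P (\<lambda>n. pmf (sum_pmf F n) (int t)) / pmf F (int t))
      \<longlonglongrightarrow> measure_pmf.expectation P real"
    by (rule random_sum_asymp[OF assms(7,10) P_moment tail P_tail])
  show ?thesis
  proof (cases "measure_pmf.expectation P real = 0")
    case False
    define e where "e = measure_pmf.expectation P real"
    have "(\<lambda>t::nat. measure_pmf.expectation P (\<lambda>n. pmf (sum_pmf F n) (int t)) / (e * pmf F (int t))) \<longlonglongrightarrow> 1"
      using tendsto_divide[OF lim tendsto_const[of e]] False by (simp add: e_def mult.commute)
    then show ?thesis
      unfolding sum_eq F(3)[symmetric] EP[symmetric] e_def[symmetric] by (rule asymp_equivI')
  next
    case True
    \<comment> \<open>An integral may be 0 by default; integrability, inherited from the higher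
      moment, excludes this. Hence N = 0 almost surely and both sides vanish for t \<ge> 1, where
      \<open>\<sim>\<close> counts 0 / 0 as 1.\<close>
    have "integrable (measure_pmf P) real"
    proof (rule Bochner_Integration.integrable_bound[OF P_moment])
      show "AE n in measure_pmf P. norm (real n) \<le> norm (real n powr (1 + \<tau>))"
      proof (rule AE_I2)
        fix n :: nat
        show "norm (real n) \<le> norm (real n powr (1 + \<tau>))"
          using powr_mono[of 1 "1 + \<tau>" "real n"] assms(10) by (cases "n = 0") auto
      qed
    qed simp
    then have "AE n in measure_pmf P. real n = 0"
      using True by (subst (asm) integral_nonneg_eq_0_iff_AE) auto
    then have N0: "AE n in measure_pmf P. n = 0" by simp
    have zero: "measure_pmf.expectation P (\<lambda>n. pmf (sum_pmf F n) (int t)) = 0" if "1 \<le> t" for t :: nat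
    proof -
      have "measure_pmf.expectation P (\<lambda>n. pmf (sum_pmf F n) (int t)) = measure_pmf.expectation P (\<lambda>_. 0)"
        using that by (intro integral_cong_AE AE_mp[OF N0 AE_I2]) (auto simp: indicator_def)
      then show ?thesis by simp
    qed
    show ?thesis
      unfolding sum_eq EP[symmetric] True asymp_equiv_def
      by (rule tendsto_eventually, use eventually_ge_at_top[of 1] in eventually_elim) (simp add: zero)
  qed
qed

end
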